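(* Fix positive constants $\alpha,\beta,\gamma$, and let $m=\beta n^{\alpha}$ and $p=\gamma n^{-(1+\alpha)/2}$. Let $G=G(n,m,p)$. Then, with high probability (as $n\to\infty$): (i) if $\alpha<1$, the model $G(n,m,p)$ is somewhere dense and $G$ has degeneracy $\Omega(\gamma n^{(1-\alpha)/2})$; (ii) if $\alpha=1$, the model $G(n,m,p)$ is somewhere dense and $G$ has degeneracy $\Omega\!\left(\frac{\log n}{\log\log n}\right)$; (iii) if $\alpha>1$, the model $G(n,m,p)$ has bounded expansion, and consequently $G$ has degeneracy $O(1)$.
   Context: Random intersection graph $G(n,m,p)$: take a random bipartite graph $B=(V,A,E)$ with $|V|=n$ vertices ("nodes"), $|A|=m$ "attributes", where each of the $nm$ possible edges between $V$ and $A$ is present independently with probability $p$. The graph $G(n,m,p)$ has vertex set $V$, and two distinct vertices are adjacent iff they have a common neighbour (attribute) in $B$. "With high probability" (w.h.p.) means with probability tending to $1$ as $n\to\infty$. For a graph $H$, a subdivision of $H$ is obtained by replacing edges of $H$ by internally vertex-disjoint paths; the vertices corresponding to $V(H)$ are called nails. For a half-integer $r\ge 0$, $H$ is an $r$-shallow topological minor of $G$ if $G$ contains as a subgraph a subdivision of $H$ in which every edge of $H$ is replaced by a path of length at most $2r+1$. The density of a graph is $|E|/|V|$. The topological grad $\tilde\nabla_r(G)$ is the maximum density of an $r$-shallow topological minor of $G$. The random graph model has bounded expansion (w.h.p.) if there is a function $f$ such that for every $r\ge0$, $\Pr[\tilde\nabla_r(G(n,m,p))\le f(r)]\to1$ as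 $n\to\infty$. The model is somewhere dense if there exists $r\ge 0$ such that for every $t$, w.h.p. the complete graph $K_t$ is an $r$-shallow topological minor of $G(n,m,p)$. Degeneracy is the usual graph degeneracy. *)

theory Defs
  imports "HOL-Probability.Probability"
begin

definition is_path :: "nat set \<Rightarrow> (nat \<Rightarrow> nat \<Rightarrow> bool) \<Rightarrow> nat list \<Rightarrow> bool" where
  "is_path V adj xs \<longleftrightarrow> xs \<noteq> [] \<and> distinct xs \<and> set xs \<subseteq> V \<and>
     (\<forall>i. Suc i < length xs \<longrightarrow> adj (xs ! i) (xs ! Suc i))"

definition inner :: "nat list \<Rightarrow> nat list" where
  "inner xs = butlast (tl xs)"

(* shallow_top_minor V adj k N EH: the graph H with vertex set N and edge set EH
   (edges stored as pairs (x,y) with x<y) is an (k/2)-shallow topological minor of G,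
   the nails being the vertices of N themselves: every edge of H is replaced by a path
   of length (number of edges) at most k+1 = 2r+1, internally disjoint from the nails
   and from each other. *)
definition shallow_top_minor ::
  "nat set \<Rightarrow> (nat \<Rightarrow> nat \<Rightarrow> bool) \<Rightarrow> nat \<Rightarrow> nat set \<Rightarrow> (nat \<times> nat) set \<Rightarrow> bool" where
  "shallow_top_minor V adj k N EH \<longleftrightarrow>
     N \<subseteq> V \<and> EH \<subseteq> {(x, y). x \<in> N \<and> y \<in> N \<and> x < y} \<and>
     (\<exists>P. (\<forall>e\<in>EH. is_path V adj (P e) \<and> hd (P e) = fst e \<and> last (P e) = snd e \<and>
                     length (P e) \<le> k + 2 \<and> set (inner (P e)) \<inter> N = {}) \<and>
          (\<forall>e\<in>EH. \<forall>e'\<in>EH. e \<noteq> e' \<longrightarrow> set (inner (P e)) \<inter> set (inner (P e')) = {}))"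

(* topological grad with parameter r = k/2: maximum density |E(H)|/|V(H)| of an
   r-shallow topological minor H (0 if there is none) *)
definition tgrad :: "nat set \<Rightarrow> (nat \<Rightarrow> nat \<Rightarrow> bool) \<Rightarrow> nat \<Rightarrow> real" where
  "tgrad V adj k = Sup (insert 0 {real (card EH) / real (card N) | N EH.
                          shallow_top_minor V adj k N EH \<and> N \<noteq> {}})"

definition has_complete_stm :: "nat set \<Rightarrow> (nat \<Rightarrow> nat \<Rightarrow> bool) \<Rightarrow> nat \<Rightarrow> nat \<Rightarrow> bool" where
  "has_complete_stm V adj k t \<longleftrightarrow>
     (\<exists>N. card N = t \<and> shallow_top_minor V adj k N {(x, y). x \<in> N \<and> y \<in> N \<and> x < y})"

definition degeneracy :: "nat set \<Rightarrow> (nat \<Rightarrow> nat \<Rightarrow> bool) \<Rightarrow> nat" where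
  "degeneracy V adj = Max {Min ((\<lambda>v. card {u \<in> S. adj v u}) ` S) | S. S \<subseteq> V \<and> S \<noteq> {}}"

definition rand_bip :: "nat \<Rightarrow> nat \<Rightarrow> real \<Rightarrow> (nat \<times> nat \<Rightarrow> bool) pmf" where
  "rand_bip n m p = Pi_pmf ({..<n} \<times> {..<m}) False (\<lambda>_. bernoulli_pmf p)"

definition RIG :: "nat \<Rightarrow> nat \<Rightarrow> real \<Rightarrow> (nat \<Rightarrow> nat \<Rightarrow> bool) pmf" where
  "RIG n m p = map_pmf (\<lambda>B u v. u \<noteq> v \<and> (\<exists>a<m. B (u, a) \<and> B (v, a))) (rand_bip n m p)"

definition whp :: "(nat \<Rightarrow> (nat \<Rightarrow> nat \<Rightarrow> bool) pmf) \<Rightarrow> (nat \<Rightarrow> (nat \<Rightarrow> nat \<Rightarrow> bool) \<Rightarrow> bool) \<Rightarrow> bool" where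
  "whp G P \<longleftrightarrow> ((\<lambda>n. measure_pmf.prob (G n) {adj. P n adj}) \<longlonglongrightarrow> 1)"

definition somewhere_dense :: "(nat \<Rightarrow> (nat \<Rightarrow> nat \<Rightarrow> bool) pmf) \<Rightarrow> bool" where
  "somewhere_dense G \<longleftrightarrow> (\<exists>k. \<forall>t. whp G (\<lambda>n adj. has_complete_stm {..<n} adj k t))"

definition bounded_expansion :: "(nat \<Rightarrow> (nat \<Rightarrow> nat \<Rightarrow> bool) pmf) \<Rightarrow> bool" where
  "bounded_expansion G \<longleftrightarrow> (\<exists>f :: nat \<Rightarrow> real. \<forall>k. whp G (\<lambda>n adj. tgrad {..<n} adj k \<le> f k))"

end

theory Submission
  imports Defs "HOL-Real_Asymp.Real_Asymp"
begin

text \<open>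
  The nodes sharing an attribute form a clique, and the number of nodes of an attribute is
  binomial with mean \<open>n p\<close>, independently for all attributes. For \<open>\<alpha> < 1\<close> this mean tends to
  infinity and a Chernoff bound for a single attribute gives a clique of size \<open>n p / 2\<close>. For
  \<open>\<alpha> = 1\<close> the mean is \<open>\<gamma>\<close>, but the largest of the linearly many independent binomials is of order
  \<open>ln n / ln ln n\<close>.

  For \<open>\<alpha> > 1\<close>, all attributes have at most \<open>D\<close> nodes for a constant \<open>D\<close>, with high probability.
  From a dense shallow topological minor one can therefore select a constant fraction of the paths
  so that, after shortcuts, no attribute is used twice. The edges of the bipartite graph that
  these paths use are all distinct, so that a path with \<open>l\<close> edges between two given nails has expected
  number of occurrences at most \<open>n ^ (l - 1) * m ^ l * p ^ (2 * l) = O(1 / n)\<close>. A first moment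
  computation over all sets of \<open>s\<close> nails and \<open>F s\<close> pairs of nails then excludes such a system of
  paths when \<open>F\<close> is a large constant. The degeneracy is at most twice the topological grad.
\<close>

section \<open>Large cliques\<close>

definition rig_adj :: "nat \<Rightarrow> (nat \<times> nat \<Rightarrow> bool) \<Rightarrow> nat \<Rightarrow> nat \<Rightarrow> bool" where
  "rig_adj m B u v \<longleftrightarrow> u \<noteq> v \<and> (\<exists>a<m. B (u, a) \<and> B (v, a))"

lemma prob_RIG:
  "measure_pmf.prob (RIG n m p) {adj. P adj} = measure_pmf.prob (rand_bip n m p) {B. P (rig_adj m B)}"
proof -
  have "RIG n m p = map_pmf (rig_adj m) (rand_bip n m p)"
    unfolding RIG_def by (intro arg_cong2[where f = map_pmf] ext) (auto simp: rig_adj_def)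
  then show ?thesis by (simp add: vimage_def)
qed

text \<open>Randomness enters the high probability statements through this form: a deterministic
  implication from an event of the bipartite graph, and a vanishing probability that the event
  fails. Taking \<open>n > 0\<close> does not affect the limit and keeps the node set nonempty, as
  the maximum in \<open>degeneracy\<close> requires.\<close>

lemma whp_RIG_I:
  assumes "\<And>n B. n > 0 \<Longrightarrow> Q n B \<Longrightarrow> P n (rig_adj (m n) B)"
    and "(\<lambda>n. measure_pmf.prob (rand_bip n (m n) (p n)) {B. \<not> Q n B}) \<longlonglongrightarrow> 0"
  shows "whp (\<lambda>n. RIG n (m n) (p n)) P"
  unfolding whp_def prob_RIG
proof (rule tendsto_sandwich)
  have *: "measure_pmf.prob (rand_bip n (m n) (p n)) {B. Q n B} =
        1 - measure_pmf.prob (rand_bip n (m n) (p n)) {B. \<not> Q n B}" for n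
    using measure_pmf.prob_compl[of "{B. \<not> Q n B}" "rand_bip n (m n) (p n)"]
    by (simp add: Compl_eq_Diff_UNIV[symmetric] Collect_neg_eq)
  show "(\<lambda>n. measure_pmf.prob (rand_bip n (m n) (p n)) {B. Q n B}) \<longlonglongrightarrow> 1"
    unfolding * using tendsto_diff[OF tendsto_const[of 1] assms(2)] by simp
  show "\<forall>\<^sub>F n in sequentially. measure_pmf.prob (rand_bip n (m n) (p n)) {B. Q n B}
      \<le> measure_pmf.prob (rand_bip n (m n) (p n)) {B. P n (rig_adj (m n) B)}"
    using eventually_gt_at_top[of 0]
    by eventually_elim (auto intro!: measure_pmf.finite_measure_mono assms(1))
qed auto

lemma whp_mono:
  assumes "whp G P" "\<forall>\<^sub>F n in sequentially. \<forall>adj. P n adj \<longrightarrow> Q n adj"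
  shows "whp G Q"
  unfolding whp_def
proof (rule tendsto_sandwich)
  show "\<forall>\<^sub>F n in sequentially. measure_pmf.prob (G n) {adj. P n adj} \<le> measure_pmf.prob (G n) {adj. Q n adj}"
    using assms(2) by eventually_elim (auto intro!: measure_pmf.finite_measure_mono)
  show "(\<lambda>n. measure_pmf.prob (G n) {adj. P n adj}) \<longlonglongrightarrow> 1"
    using assms(1) by (simp add: whp_def)
qed auto

section \<open>Cliques as complete minors and as witnesses for the degeneracy\<close>

definition is_clique :: "(nat \<Rightarrow> nat \<Rightarrow> bool) \<Rightarrow> nat set \<Rightarrow> bool" where
  "is_clique adj C \<longleftrightarrow> (\<forall>x\<in>C. \<forall>y\<in>C. x \<noteq> y \<longrightarrow> adj x y)"

lemma is_path_edge: "is_path V adj [x, y] \<longleftrightarrow> x \<noteq> y \<and> x \<in> V \<and> y \<in> V \<and> adj x y"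
  by (auto simp: is_path_def)

text \<open>A subgraph is a minor at every depth: each edge is its own path, and a path with one
  edge has no inner nodes.\<close>

lemma edges_shallow_top_minor:
  assumes "N \<subseteq> V" "EH \<subseteq> {(x, y). x \<in> N \<and> y \<in> N \<and> x < y \<and> adj x y}"
  shows "shallow_top_minor V adj k N EH"
  unfolding shallow_top_minor_def
proof (intro conjI exI[of _ "\<lambda>e. [fst e, snd e]"])
  show "\<forall>e\<in>EH. is_path V adj [fst e, snd e] \<and> hd [fst e, snd e] = fst e \<and>
      last [fst e, snd e] = snd e \<and> length [fst e, snd e] \<le> k + 2 \<and>
      set (inner [fst e, snd e]) \<inter> N = {}"
    using assms by (fastforce simp: is_path_edge inner_def)
qed (use assms in \<open>auto simp: inner_def\<close>)

lemma clique_has_complete_stm: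
  assumes "C \<subseteq> V" "is_clique adj C" "t \<le> card C"
  shows "has_complete_stm V adj k t"
proof -
  obtain N where N: "N \<subseteq> C" "card N = t"
    using assms(3) by (meson obtain_subset_with_card_n)
  have "shallow_top_minor V adj k N {(x, y). x \<in> N \<and> y \<in> N \<and> x < y}"
    using N assms by (intro edges_shallow_top_minor) (auto simp: is_clique_def subset_iff)
  with N show ?thesis by (auto simp: has_complete_stm_def)
qed

lemma finite_min_degrees:
  assumes "finite V"
  shows "finite {Min ((\<lambda>v. card {u \<in> S. adj v u}) ` S) | S. S \<subseteq> V \<and> S \<noteq> {}}"
proof -
  have "{Min ((\<lambda>v. card {u \<in> S. adj v u}) ` S) | S. S \<subseteq> V \<and> S \<noteq> {}}
      \<subseteq> (\<lambda>S. Min ((\<lambda>v. card {u \<in> S. adj v u}) ` S)) ` Pow V" by auto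
  then show ?thesis by (rule finite_subset) (use assms in simp)
qed

text \<open>The clique itself is one of the sets \<open>S\<close> in the maximum, and inside it each
  node has degree at least the size minus one.\<close>

lemma clique_degeneracy_ge:
  assumes "finite V" "C \<subseteq> V" "is_clique adj C"
  shows "card C \<le> Suc (degeneracy V adj)"
proof (cases "C = {}")
  case False
  have fin: "finite C" using assms finite_subset by blast
  have "card C - 1 \<le> Min ((\<lambda>v. card {u \<in> C. adj v u}) ` C)"
  proof (rule Min.boundedI)
    fix d assume "d \<in> (\<lambda>v. card {u \<in> C. adj v u}) ` C"
    then obtain v where v: "v \<in> C" "d = card {u \<in> C. adj v u}" by blast
    have "card (C - {v}) \<le> card {u \<in> C. adj v u}"
      using assms v fin by (intro card_mono) (auto simp: is_clique_def)
    with v fin show "card C - 1 \<le> d" by simp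
  qed (use fin False in auto)
  also have "\<dots> \<le> degeneracy V adj"
    unfolding degeneracy_def using assms False by (intro Max_ge finite_min_degrees) auto
  finally show ?thesis by simp
qed simp

section \<open>Sizes of the attributes\<close>

lemma prob_pair_pmf_Times:
  "measure_pmf.prob (pair_pmf M N) (A \<times> B) = measure_pmf.prob M A * measure_pmf.prob N B"
proof -
  \<comment> \<open>\<open>A\<close> and \<open>B\<close> may be uncountable; the supports are
    countable and carry all the mass.\<close>
  have "measure_pmf.prob (pair_pmf M N) (A \<times> B) =
      measure_pmf.prob (pair_pmf M N) ((A \<inter> set_pmf M) \<times> (B \<inter> set_pmf N))"
    by (subst measure_Int_set_pmf[symmetric]) (simp add: Times_Int_Times)
  also have "\<dots> = measure_pmf.prob M (A \<inter> set_pmf M) * measure_pmf.prob N (B \<inter> set_pmf N)"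
    by (rule measure_pmf_prob_product) auto
  finally show ?thesis by (simp add: measure_Int_set_pmf)
qed

text \<open>The attributes are independent columns of the incidence matrix. The induction splits off
  the last column, in which the number of nodes is a sum of \<open>n\<close> independent Bernoulli
  variables.\<close>

lemma prob_attributes_small:
  assumes p: "p \<in> {0..1}"
  shows "measure_pmf.prob (rand_bip n m p) {B. \<forall>a<m. card {u. u < n \<and> B (u, a)} < q} =
    measure_pmf.prob (binomial_pmf n p) {..<q} ^ m"
proof (induction m)
  case 0
  then show ?case by (simp add: rand_bip_def)
next
  case (Suc m)
  let ?A = "{..<n} \<times> {..<m}" and ?C = "{..<n} \<times> {m}"
  let ?b = "\<lambda>_::nat \<times> nat. bernoulli_pmf p"
  let ?col = "\<lambda>a (B::nat \<times> nat \<Rightarrow> bool). card {u. u < n \<and> B (u, a)}"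
  have un: "{..<n} \<times> {..<Suc m} = ?A \<union> ?C" by auto
  have col: "?col m B = card {x \<in> ?C. B x}" for B
    by (rule bij_betw_same_card[of "\<lambda>u. (u, m)"]) (auto simp: bij_betw_def inj_on_def)
  have "rand_bip n (Suc m) p = map_pmf (\<lambda>(f, g) x. if x \<in> ?A then f x else g x)
      (pair_pmf (Pi_pmf ?A False ?b) (Pi_pmf ?C False ?b))"
    unfolding rand_bip_def un by (rule Pi_pmf_union) auto
  then have "measure_pmf.prob (rand_bip n (Suc m) p) {B. \<forall>a<Suc m. ?col a B < q} =
      measure_pmf.prob (pair_pmf (Pi_pmf ?A False ?b) (Pi_pmf ?C False ?b))
        {(f, g). \<forall>a<Suc m. ?col a (\<lambda>x. if x \<in> ?A then f x else g x) < q}"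
    by (simp add: vimage_def case_prod_unfold)
  \<comment> \<open>The combined function agrees with \<open>f\<close> on the first \<open>m\<close>
    columns and with \<open>g\<close> on the last one, so the event is a rectangle.\<close>
  also have "{(f, g). \<forall>a<Suc m. ?col a (\<lambda>x. if x \<in> ?A then f x else g x) < q} =
      {f. \<forall>a<m. ?col a f < q} \<times> {g. ?col m g < q}"
    by (auto simp: less_Suc_eq cong: conj_cong)
  also have "measure_pmf.prob (pair_pmf (Pi_pmf ?A False ?b) (Pi_pmf ?C False ?b)) \<dots> =
      measure_pmf.prob (Pi_pmf ?A False ?b) {f. \<forall>a<m. ?col a f < q} *
      measure_pmf.prob (Pi_pmf ?C False ?b) {g. ?col m g < q}"
    by (rule prob_pair_pmf_Times)
  also have "measure_pmf.prob (Pi_pmf ?C False ?b) {g. ?col m g < q} =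
      measure_pmf.prob (binomial_pmf n p) {..<q}"
    by (subst binomial_pmf_altdef'[where A = ?C and dflt = False])
      (use p in \<open>auto simp: card_cartesian_product vimage_def col\<close>)
  also have "measure_pmf.prob (Pi_pmf ?A False ?b) {f. \<forall>a<m. ?col a f < q} =
      measure_pmf.prob (binomial_pmf n p) {..<q} ^ m"
    using Suc.IH by (simp add: rand_bip_def)
  finally show ?case by simp
qed

text \<open>Markov's inequality for \<open>2\<close> to the power of minus a binomial variable.\<close>

lemma binomial_lower_tail:
  assumes p: "p \<in> {0..1}"
  shows "measure_pmf.prob (binomial_pmf n p) {..<q} \<le> 2 ^ q * exp (- (real n * p) / 2)"
proof -
  have "measure_pmf.prob (binomial_pmf n p) {..<q} = (\<Sum>k<q. pmf (binomial_pmf n p) k)"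
    by (simp add: measure_measure_pmf_finite)
  also have "\<dots> \<le> (\<Sum>k<q. 2 ^ q * (real (n choose k) * (p / 2) ^ k * (1 - p) ^ (n - k)))"
  proof (rule sum_mono)
    fix k assume k: "k \<in> {..<q}"
    have "p ^ k = 2 ^ k * (p / 2) ^ k"
      by (simp flip: power_mult_distrib)
    also have "\<dots> \<le> 2 ^ q * (p / 2) ^ k"
      using k p by (intro mult_right_mono power_increasing) auto
    finally have "(real (n choose k) * (1 - p) ^ (n - k)) * p ^ k
        \<le> (real (n choose k) * (1 - p) ^ (n - k)) * (2 ^ q * (p / 2) ^ k)"
      using p by (intro mult_left_mono) auto
    then show "pmf (binomial_pmf n p) k \<le> 2 ^ q * (real (n choose k) * (p / 2) ^ k * (1 - p) ^ (n - k))"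
      using p by (simp add: mult_ac)
  qed
  also have "\<dots> = 2 ^ q * (\<Sum>k<q. real (n choose k) * (p / 2) ^ k * (1 - p) ^ (n - k))"
    by (simp add: sum_distrib_left)
  also have "(\<Sum>k<q. real (n choose k) * (p / 2) ^ k * (1 - p) ^ (n - k)) =
      (\<Sum>k\<in>{..<q} \<inter> {..n}. real (n choose k) * (p / 2) ^ k * (1 - p) ^ (n - k))"
    by (rule sum.mono_neutral_right) (auto simp: binomial_eq_0)
  also have "\<dots> \<le> (\<Sum>k\<le>n. real (n choose k) * (p / 2) ^ k * (1 - p) ^ (n - k))"
    using p by (intro sum_mono2) auto
  also have "\<dots> = (1 - p / 2) ^ n"
    using binomial_ring[of "p / 2" "1 - p" n] by (simp add: algebra_simps)
  also have "\<dots> \<le> exp (- p / 2) ^ n"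
    using p exp_ge_add_one_self[of "- p / 2"] by (intro power_mono) auto
  also have "\<dots> = exp (- (real n * p) / 2)"
    by (simp flip: exp_of_nat_mult)
  finally show ?thesis by simp
qed

text \<open>The single value \<open>q\<close> already has enough mass: the binomial coefficient is
  at least \<open>(n / q) ^ q\<close>, and the exponent \<open>n - q\<close> of \<open>1 - p\<close>
  may be raised to \<open>n\<close>.\<close>

lemma binomial_below_le:
  assumes p: "p \<in> {0..1}" and q: "q \<le> n"
  shows "measure_pmf.prob (binomial_pmf n p) {..<q} \<le> 1 - (real n * p / real q) ^ q * (1 - p) ^ n"
proof -
  have "(real n * p / real q) ^ q * (1 - p) ^ n = (real n / real q) ^ q * p ^ q * (1 - p) ^ n"
    by (simp flip: power_mult_distrib)
  also have "\<dots> \<le> real (n choose q) * p ^ q * (1 - p) ^ (n - q)"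
    using p q binomial_ge_n_over_k_pow_k[OF q, where 'a = real]
    by (intro mult_mono power_decreasing) auto
  also have "\<dots> = measure_pmf.prob (binomial_pmf n p) {q}"
    using p by (simp add: measure_pmf_single)
  also have "\<dots> \<le> measure_pmf.prob (binomial_pmf n p) (UNIV - {..<q})"
    by (intro measure_pmf.finite_measure_mono) auto
  also have "\<dots> = 1 - measure_pmf.prob (binomial_pmf n p) {..<q}"
    using measure_pmf.prob_compl[of "{..<q}" "binomial_pmf n p"] by simp
  finally show ?thesis by simp
qed

text \<open>The clique is the node set of one attribute. By independence, the power in the second
  assumption is the probability that every attribute is too small.\<close>

lemma whp_large_clique:
  assumes "\<forall>\<^sub>F n in sequentially. p n \<in> {0..1}"
    and "(\<lambda>n. measure_pmf.prob (binomial_pmf n (p n)) {..<q n} ^ m n) \<longlonglongrightarrow> 0"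
  shows "whp (\<lambda>n. RIG n (m n) (p n)) (\<lambda>n adj. \<exists>C\<subseteq>{..<n}. is_clique adj C \<and> q n \<le> card C)"
proof (rule whp_RIG_I[where Q = "\<lambda>n B. \<exists>a<m n. q n \<le> card {u. u < n \<and> B (u, a)}"])
  fix n B assume "\<exists>a<m n. q n \<le> card {u. u < n \<and> B (u, a)}"
  then obtain a where "a < m n" "q n \<le> card {u. u < n \<and> B (u, a)}" by blast
  then show "\<exists>C\<subseteq>{..<n}. is_clique (rig_adj (m n) B) C \<and> q n \<le> card C"
    by (intro exI[of _ "{u. u < n \<and> B (u, a)}"]) (auto simp: is_clique_def rig_adj_def)
next
  show "(\<lambda>n. measure_pmf.prob (rand_bip n (m n) (p n))
      {B. \<not> (\<exists>a<m n. q n \<le> card {u. u < n \<and> B (u, a)})}) \<longlonglongrightarrow> 0"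
  proof (rule Lim_transform_eventually[OF assms(2)])
    show "\<forall>\<^sub>F n in sequentially. measure_pmf.prob (binomial_pmf n (p n)) {..<q n} ^ m n =
      measure_pmf.prob (rand_bip n (m n) (p n)) {B. \<not> (\<exists>a<m n. q n \<le> card {u. u < n \<and> B (u, a)})}"
      using assms(1)
      by eventually_elim (auto simp: prob_attributes_small[symmetric] not_le)
  qed
qed

text \<open>Depth 0 works for every \<open>t\<close>: a complete graph inside the clique needs no
  subdivision.\<close>

lemma large_clique_somewhere_dense:
  assumes "whp G (\<lambda>n adj. \<exists>C\<subseteq>{..<n}. is_clique adj C \<and> q n \<le> card C)"
    and "filterlim q at_top sequentially"
  shows "somewhere_dense G"
  unfolding somewhere_dense_def
proof (intro exI[of _ 0] allI)
  fix t
  have "\<forall>\<^sub>F n in sequentially. t \<le> q n" using assms(2) by (simp add: filterlim_at_top)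
  then show "whp G (\<lambda>n adj. has_complete_stm {..<n} adj 0 t)"
    by (intro whp_mono[OF assms(1)], eventually_elim)
      (auto intro: clique_has_complete_stm order_trans)
qed

text \<open>The added one pays for the degree in a clique, which is one below its size.\<close>

lemma large_clique_degeneracy:
  assumes "whp G (\<lambda>n adj. \<exists>C\<subseteq>{..<n}. is_clique adj C \<and> q n \<le> card C)"
    and "\<forall>\<^sub>F n in sequentially. r n + 1 \<le> real (q n)"
  shows "whp G (\<lambda>n adj. real (degeneracy {..<n} adj) \<ge> r n)"
  using assms(2)
proof (intro whp_mono[OF assms(1)], eventually_elim)
  case (elim n)
  show ?case
  proof clarify
    fix adj C assume "C \<subseteq> {..<n}" "is_clique adj C" "q n \<le> card C"
    then have "q n \<le> Suc (degeneracy {..<n} adj)"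
      using clique_degeneracy_ge[of "{..<n}" C adj] by simp
    then have "real (q n) \<le> 1 + real (degeneracy {..<n} adj)" by linarith
    with elim show "r n \<le> real (degeneracy {..<n} adj)" by linarith
  qed
qed

section \<open>The regimes \<alpha> < 1 and \<alpha> = 1\<close>

lemma floor_nat_bounds:
  fixes x :: real
  assumes "x \<ge> 0"
  shows "real (nat \<lfloor>x\<rfloor>) \<le> x" "x - 1 < real (nat \<lfloor>x\<rfloor>)"
  using assms by (auto simp: of_nat_nat)

lemma edge_probability_in_unit:
  fixes \<alpha> \<gamma> :: real
  assumes "\<alpha> > 0" "\<gamma> > 0"
  shows "\<forall>\<^sub>F n in sequentially. \<gamma> * real n powr (-(1 + \<alpha>) / 2) \<in> {0..1}"
proof -
  have "(\<lambda>n. \<gamma> * real n powr (-(1 + \<alpha>) / 2)) \<longlonglongrightarrow> 0"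
    using assms by real_asymp
  then have "\<forall>\<^sub>F n in sequentially. \<gamma> * real n powr (-(1 + \<alpha>) / 2) < 1"
    by (rule order_tendstoD) simp
  then show ?thesis by eventually_elim (use assms in auto)
qed

text \<open>A single attribute suffices. Its size has mean \<open>\<mu> n\<close>, and asking for
  half the mean leaves a failure probability of at most
  \<open>2 powr (\<mu> n / 2) * exp (- \<mu> n / 2)\<close>, which vanishes because
  \<open>ln 2 < 1\<close>.\<close>

lemma dense_regime:
  fixes \<alpha> \<beta> \<gamma> :: real
  assumes "\<alpha> > 0" "\<beta> > 0" "\<gamma> > 0" "\<alpha> < 1"
  defines "G \<equiv> (\<lambda>n::nat. RIG n (nat \<lfloor>\<beta> * real n powr \<alpha>\<rfloor>) (\<gamma> * real n powr (-(1 + \<alpha>) / 2)))"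
  shows "somewhere_dense G"
    and "whp G (\<lambda>n adj. real (degeneracy {..<n} adj) \<ge> 1 / 4 * \<gamma> * real n powr ((1 - \<alpha>) / 2))"
proof -
  define m where "m n = nat \<lfloor>\<beta> * real n powr \<alpha>\<rfloor>" for n :: nat
  define p where "p n = \<gamma> * real n powr (-(1 + \<alpha>) / 2)" for n :: nat
  define \<mu> where "\<mu> n = \<gamma> * real n powr ((1 - \<alpha>) / 2)" for n :: nat
  define q where "q n = nat \<lfloor>\<mu> n / 2\<rfloor>" for n
  have G: "G = (\<lambda>n. RIG n (m n) (p n))" by (simp add: G_def m_def p_def)
  have p01: "\<forall>\<^sub>F n in sequentially. p n \<in> {0..1}"
    unfolding p_def using assms by (intro edge_probability_in_unit)
  have \<mu>_nonneg: "\<mu> n \<ge> 0" for n using assms by (simp add: \<mu>_def)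
  have np: "real n * p n = \<mu> n" if "n > 0" for n
  proof -
    have "real n * real n powr (-(1 + \<alpha>) / 2) = real n powr 1 * real n powr (-(1 + \<alpha>) / 2)"
      using that by simp
    also have "\<dots> = real n powr ((1 - \<alpha>) / 2)"
      by (subst powr_add[symmetric]) (simp add: field_simps)
    finally show ?thesis by (simp add: p_def \<mu>_def)
  qed
  have \<mu>_lim: "filterlim \<mu> at_top sequentially"
    unfolding \<mu>_def using assms by real_asymp
  have "filterlim (\<lambda>n. \<beta> * real n powr \<alpha>) at_top sequentially"
    using assms by real_asymp
  then have "\<forall>\<^sub>F n in sequentially. \<beta> * real n powr \<alpha> \<ge> 1"
    by (simp add: filterlim_at_top)
  then have m1: "\<forall>\<^sub>F n in sequentially. m n \<ge> 1"
    by eventually_elim (simp add: m_def le_nat_iff le_floor_iff)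
  have bound: "\<forall>\<^sub>F n in sequentially. measure_pmf.prob (binomial_pmf n (p n)) {..<q n} ^ m n
      \<le> exp (- (1 - ln 2) / 2 * \<mu> n)"
    using p01 m1 eventually_gt_at_top[of 0]
  proof eventually_elim
    case (elim n)
    let ?\<phi> = "measure_pmf.prob (binomial_pmf n (p n)) {..<q n}"
    have "?\<phi> ^ m n \<le> ?\<phi> ^ 1"
      using elim by (intro power_decreasing) auto
    also have "?\<phi> ^ 1 \<le> 2 ^ q n * exp (- \<mu> n / 2)"
      using binomial_lower_tail[of "p n" n "q n"] elim np[of n] by simp
    also have "(2::real) ^ q n = exp (real (q n) * ln 2)"
      by (simp add: exp_of_nat_mult)
    also have "\<dots> \<le> exp (\<mu> n / 2 * ln 2)"
      using floor_nat_bounds(1)[of "\<mu> n / 2"] \<mu>_nonneg by (simp add: q_def)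
    also have "exp (\<mu> n / 2 * ln 2) * exp (- \<mu> n / 2) = exp (- (1 - ln 2) / 2 * \<mu> n)"
      by (simp add: mult_exp_exp field_simps)
    finally show ?case by simp
  qed
  have "(1 - ln 2 :: real) > 0"
    using ln_less_self[of 2] ln_2_less_1 by simp
  then have "((\<lambda>x::real. exp (- (1 - ln 2) / 2 * x)) \<longlongrightarrow> 0) at_top" by real_asymp
  then have "(\<lambda>n. exp (- (1 - ln 2) / 2 * \<mu> n)) \<longlonglongrightarrow> 0"
    using \<mu>_lim by (rule filterlim_compose)
  then have lim0: "(\<lambda>n. measure_pmf.prob (binomial_pmf n (p n)) {..<q n} ^ m n) \<longlonglongrightarrow> 0"
    using bound by (intro tendsto_sandwich[OF _ bound tendsto_const[of 0]]) auto
  have clique: "whp G (\<lambda>n adj. \<exists>C\<subseteq>{..<n}. is_clique adj C \<and> q n \<le> card C)"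
    unfolding G by (rule whp_large_clique[OF p01 lim0])
  have "filterlim (\<lambda>x::real. nat \<lfloor>x / 2\<rfloor>) at_top at_top" by real_asymp
  then have "filterlim q at_top sequentially"
    unfolding q_def using \<mu>_lim by (rule filterlim_compose)
  then show "somewhere_dense G"
    using large_clique_somewhere_dense[OF clique] by blast
  \<comment> \<open>From 8 on, the rounding loss and the added one both fit between
    \<open>\<mu> n / 4\<close> and \<open>\<mu> n / 2\<close>.\<close>
  have "\<forall>\<^sub>F n in sequentially. \<mu> n \<ge> 8" using \<mu>_lim by (simp add: filterlim_at_top)
  then have "\<forall>\<^sub>F n in sequentially. 1 / 4 * \<mu> n + 1 \<le> real (q n)"
  proof eventually_elim
    case (elim n)
    then show ?case
      unfolding q_def using floor_nat_bounds(2)[of "\<mu> n / 2"] by linarith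
  qed
  from large_clique_degeneracy[OF clique this]
  show "whp G (\<lambda>n adj. real (degeneracy {..<n} adj) \<ge> 1 / 4 * \<gamma> * real n powr ((1 - \<alpha>) / 2))"
    by (simp add: \<mu>_def mult.assoc)
qed

text \<open>Let L = ln n. An attribute reaches the size L / (2 ln L) with probability at least of
  order n^(-3/4), and there are linearly many independent attributes. All of them fail with
  probability at most exp (- C n^(1/4)), up to lower order terms in the exponent, for some C >
  0.\<close>

lemma critical_regime:
  fixes \<beta> \<gamma> :: real
  assumes "\<beta> > 0" "\<gamma> > 0"
  defines "G \<equiv> (\<lambda>n::nat. RIG n (nat \<lfloor>\<beta> * real n powr 1\<rfloor>) (\<gamma> * real n powr (-(1 + 1) / 2)))"
  shows "somewhere_dense G"
    and "whp G (\<lambda>n adj. real (degeneracy {..<n} adj) \<ge> 1 / 4 * ln (real n) / ln (ln (real n)))"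
proof -
  define m where "m n = nat \<lfloor>\<beta> * real n powr 1\<rfloor>" for n :: nat
  define p where "p n = \<gamma> * real n powr (-(1 + 1) / 2)" for n :: nat
  define \<rho> where "\<rho> n = ln (real n) / (2 * ln (ln (real n)))" for n :: nat
  define q where "q n = nat \<lfloor>\<rho> n\<rfloor>" for n
  \<comment> \<open>An upper bound for \<open>- ln \<gamma>\<close>, which is positive when \<gamma>
    < 1.\<close>
  define K where "K = \<bar>ln \<gamma>\<bar>"
  have G: "G = (\<lambda>n. RIG n (m n) (p n))" by (simp add: G_def m_def p_def)
  have p01: "\<forall>\<^sub>F n in sequentially. p n \<in> {0..1}"
    unfolding p_def using assms edge_probability_in_unit[of 1 \<gamma>] by simp
  have p: "p n = \<gamma> / real n" for n by (cases "n = 0") (simp_all add: p_def powr_minus_divide)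
  have \<rho>_lim: "filterlim \<rho> at_top sequentially" unfolding \<rho>_def by real_asymp
  have "filterlim (\<lambda>x::real. nat \<lfloor>x\<rfloor>) at_top at_top" by real_asymp
  then have q_lim: "filterlim q at_top sequentially"
    unfolding q_def using \<rho>_lim by (rule filterlim_compose)
  have e1: "\<forall>\<^sub>F n in sequentially. \<rho> n \<le> real n" unfolding \<rho>_def by real_asymp
  have e2: "\<forall>\<^sub>F n in sequentially. \<rho> n \<ge> 8" using \<rho>_lim by (simp add: filterlim_at_top)
  have e3: "\<forall>\<^sub>F n in sequentially. ln (ln (real n)) \<ge> max 1 (2 * K)"
  proof -
    have "filterlim (\<lambda>n::nat. ln (ln (real n))) at_top sequentially" by real_asymp
    then show ?thesis unfolding filterlim_at_top by blast
  qed
  \<comment> \<open>The limit is \<open>exp (- \<gamma>)\<close>, so half of it is a lower bound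
    from some \<open>n\<close> on.\<close>
  have e4: "\<forall>\<^sub>F n in sequentially. (1 - p n) ^ n \<ge> exp (- \<gamma>) / 2"
  proof -
    have "(\<lambda>n. (1 + (- \<gamma>) / real n) ^ n) \<longlonglongrightarrow> exp (- \<gamma>)" by (rule tendsto_exp_limit_sequentially)
    then have "\<forall>\<^sub>F n in sequentially. (1 + (- \<gamma>) / real n) ^ n > exp (- \<gamma>) / 2"
      by (rule order_tendstoD) simp
    then show ?thesis by eventually_elim (simp add: p)
  qed
  have bound: "\<forall>\<^sub>F n in sequentially. measure_pmf.prob (binomial_pmf n (p n)) {..<q n} ^ m n
      \<le> exp (- (exp (- (3 / 4) * ln (real n)) * (exp (- \<gamma>) / 2) * (\<beta> * real n - 1)))"
    using p01 e1 e2 e3 e4 eventually_gt_at_top[of 3]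
  proof eventually_elim
    case (elim n)
    let ?\<phi> = "measure_pmf.prob (binomial_pmf n (p n)) {..<q n}"
    define L where "L = ln (real n)"
    have L: "ln L \<ge> 1" "ln L \<ge> 2 * K" using elim by (auto simp: L_def)
    have "L > 1"
    proof -
      have "L > 0" unfolding L_def using elim by (intro ln_gt_zero) auto
      then show ?thesis using L ln_gt_zero_imp_gt_one[of L] by linarith
    qed
    have q_le: "real (q n) \<le> \<rho> n" and q_gt: "real (q n) > \<rho> n - 1"
      using floor_nat_bounds[of "\<rho> n"] elim by (auto simp: q_def)
    have q0: "real (q n) > 0" and "q n \<le> n" using q_le q_gt elim by linarith+
    have \<rho>L: "\<rho> n = L / (2 * ln L)" by (simp add: \<rho>_def L_def)
    have "\<rho> n \<le> L" using L \<open>L > 1\<close> by (simp add: \<rho>L divide_le_eq mult_le_cancel_left1)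
    then have "ln (real (q n)) \<le> ln L" using q_le q0 \<open>L > 1\<close> by simp
    \<comment> \<open>As \<open>\<rho> n * ln L = L / 2\<close>, the additional half of
      \<open>ln L\<close> that absorbs \<open>K\<close> turns the factor 1/2 in the exponent into
      3/4.\<close>
    then have "ln (real (q n)) + K \<le> ln L + ln L / 2" using L by linarith
    then have "real (q n) * (ln (real (q n)) + K) \<le> \<rho> n * (ln L + ln L / 2)"
      using q_le q0 L elim by (intro mult_mono') (auto simp: K_def intro!: add_nonneg_nonneg)
    also have "\<dots> = 3 / 4 * L" using L by (simp add: \<rho>L field_simps)
    finally have "- (3 / 4) * L \<le> real (q n) * (- K - ln (real (q n)))" by (simp add: algebra_simps)
    also have "\<dots> \<le> real (q n) * ln (\<gamma> / real (q n))"
      using q0 assms by (intro mult_left_mono) (auto simp: ln_div K_def)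
    finally have "exp (- (3 / 4) * L) \<le> exp (real (q n) * ln (\<gamma> / real (q n)))" by simp
    also have "\<dots> = (\<gamma> / real (q n)) ^ q n"
      using q0 assms by (subst exp_of_nat_mult) simp
    also have "\<gamma> / real (q n) = real n * p n / real (q n)" using elim by (simp add: p)
    finally have pow: "exp (- (3 / 4) * L) \<le> (real n * p n / real (q n)) ^ q n" .
    define \<pi> where "\<pi> = exp (- (3 / 4) * L) * (exp (- \<gamma>) / 2)"
    have "\<pi> \<le> (real n * p n / real (q n)) ^ q n * (1 - p n) ^ n"
      unfolding \<pi>_def using pow elim by (intro mult_mono) auto
    then have "?\<phi> \<le> 1 + - \<pi>"
      using binomial_below_le[of "p n" "q n" n] \<open>q n \<le> n\<close> elim by linarith
    also have "\<dots> \<le> exp (- \<pi>)" by (rule exp_ge_add_one_self)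
    finally have "?\<phi> ^ m n \<le> exp (- \<pi>) ^ m n" by (intro power_mono) auto
    also have "\<dots> = exp (- (\<pi> * real (m n)))" by (simp flip: exp_of_nat_mult add: mult.commute)
    also have "\<dots> \<le> exp (- (\<pi> * (\<beta> * real n - 1)))"
      using floor_nat_bounds(2)[of "\<beta> * real n"] assms
      by (auto simp: m_def \<pi>_def intro!: mult_left_mono)
    finally show ?case by (simp add: \<pi>_def L_def)
  qed
  have "(\<lambda>n::nat. exp (- (exp (- (3 / 4) * ln (real n)) * (exp (- \<gamma>) / 2) * (\<beta> * real n - 1)))) \<longlonglongrightarrow> 0"
    using assms by real_asymp
  then have lim0: "(\<lambda>n. measure_pmf.prob (binomial_pmf n (p n)) {..<q n} ^ m n) \<longlonglongrightarrow> 0"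
    using bound by (intro tendsto_sandwich[OF _ bound tendsto_const[of 0]]) auto
  have clique: "whp G (\<lambda>n adj. \<exists>C\<subseteq>{..<n}. is_clique adj C \<and> q n \<le> card C)"
    unfolding G by (rule whp_large_clique[OF p01 lim0])
  show "somewhere_dense G"
    using large_clique_somewhere_dense[OF clique q_lim] .
  have "\<forall>\<^sub>F n in sequentially. 1 / 4 * ln (real n) / ln (ln (real n)) + 1 \<le> real (q n)"
    using e2
  proof eventually_elim
    case (elim n)
    \<comment> \<open>The constant 1/4 asks for only half of \<open>\<rho> n\<close>, which leaves
      room for the rounding and the added one.\<close>
    have "1 / 4 * ln (real n) / ln (ln (real n)) = \<rho> n / 2" by (simp add: \<rho>_def)
    with elim show ?case
      unfolding q_def using floor_nat_bounds(2)[of "\<rho> n"] by linarith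
  qed
  from large_clique_degeneracy[OF clique this]
  show "whp G (\<lambda>n adj. real (degeneracy {..<n} adj) \<ge> 1 / 4 * ln (real n) / ln (ln (real n)))" .
qed

section \<open>Trails with pairwise distinct attributes\<close>

text \<open>A trail from a node \<open>u\<close> is encoded by the list of its steps \<open>(a, x)\<close>, meaning: go via the
  attribute \<open>a\<close> to the node \<open>x\<close>. Then \<open>trail_pairs u T\<close> is the set of edges of the bipartite graph
  that it uses.\<close>

fun trail_pairs :: "nat \<Rightarrow> (nat \<times> nat) list \<Rightarrow> (nat \<times> nat) set" where
  "trail_pairs u [] = {}"
| "trail_pairs u ((a, x) # T) = {(u, a), (x, a)} \<union> trail_pairs x T"

text \<open>Neighbouring nodes differ, so that a step uses two distinct bipartite edges. A node may
  still recur further along.\<close>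

fun loopless :: "nat \<Rightarrow> (nat \<times> nat) list \<Rightarrow> bool" where
  "loopless u [] \<longleftrightarrow> True"
| "loopless u ((a, x) # T) \<longleftrightarrow> u \<noteq> x \<and> loopless x T"

text \<open>Distinctness is imposed on the attributes rather than on the nodes: this keeps the
  bipartite edges of different steps apart.\<close>

definition trail :: "(nat \<times> nat \<Rightarrow> bool) \<Rightarrow> nat \<Rightarrow> (nat \<times> nat) list \<Rightarrow> bool" where
  "trail B u T \<longleftrightarrow> loopless u T \<and> distinct (map fst T) \<and> (\<forall>z\<in>trail_pairs u T. B z)"

text \<open>A path with at most \<open>k + 2\<close> nodes has at most \<open>Suc k\<close> steps.
  The start is not part of the encoding, hence only the end is prescribed.\<close>

definition trails_to :: "nat \<Rightarrow> nat \<Rightarrow> nat \<Rightarrow> nat \<Rightarrow> (nat \<times> nat) list set" where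
  "trails_to n m k v =
     {T. T \<noteq> [] \<and> length T \<le> Suc k \<and> set T \<subseteq> {..<m} \<times> {..<n} \<and> snd (last T) = v}"

definition attrs :: "(nat \<times> nat) list \<Rightarrow> nat set" where
  "attrs T = fst ` set T"

lemma snd_trail_pairs: "snd ` trail_pairs u T = attrs T"
  by (induction u T rule: trail_pairs.induct) (auto simp: attrs_def)

text \<open>Edges of different steps differ in the attribute, and the two edges of one step differ
  in the node.\<close>

lemma card_trail_pairs:
  assumes "loopless u T" "distinct (map fst T)"
  shows "card (trail_pairs u T) = 2 * length T"
  using assms
proof (induction u T rule: trail_pairs.induct)
  case (2 u a x T)
  have "finite (trail_pairs x T)" by (induction x T rule: trail_pairs.induct) auto
  moreover have "(v, a) \<notin> trail_pairs x T" for v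
  proof
    assume "(v, a) \<in> trail_pairs x T"
    then have "a \<in> attrs T" by (force simp flip: snd_trail_pairs[of x])
    with 2 show False by (auto simp: attrs_def)
  qed
  ultimately show ?case using 2 by (auto simp: card_insert_if)
qed auto

lemma trail_pairs_subset:
  assumes "u < n" "set T \<subseteq> {..<m} \<times> {..<n}"
  shows "trail_pairs u T \<subseteq> {..<n} \<times> {..<m}"
  using assms by (induction u T rule: trail_pairs.induct) auto

text \<open>Provides what remains of a trail after a shortcut: the part behind the step via
  \<open>a\<close> can be entered at \<open>y\<close> from any other node of
  \<open>a\<close>.\<close>

lemma trail_suffix:
  assumes "loopless u (T1 @ (a, y) # T2)" "\<forall>z\<in>trail_pairs u (T1 @ (a, y) # T2). B z"
  shows "B (y, a)" "loopless y T2" "\<forall>z\<in>trail_pairs y T2. B z"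
proof -
  have "B (y, a) \<and> loopless y T2 \<and> (\<forall>z\<in>trail_pairs y T2. B z)"
    using assms
  proof (induction T1 arbitrary: u)
    case (Cons b T1)
    obtain c w where b: "b = (c, w)" by (cases b)
    show ?case using Cons.IH[of w] Cons.prems by (simp add: b)
  qed simp
  then show "B (y, a)" "loopless y T2" "\<forall>z\<in>trail_pairs y T2. B z" by blast+
qed

text \<open>The two nodes are the ends of the step via \<open>a\<close>. They serve later as a label
  for a path that uses \<open>a\<close>.\<close>

lemma trail_attr_cases:
  assumes "trail B u T" "a \<in> attrs T"
  shows "\<exists>x y. x \<noteq> y \<and> B (x, a) \<and> B (y, a) \<and> x \<in> insert u (snd ` set T) \<and> y \<in> snd ` set T"
  using assms
proof (induction u T rule: trail_pairs.induct)
  case (2 u b x T)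
  show ?case
  proof (cases "a = b")
    case True
    with 2 show ?thesis by (intro exI[of _ u] exI[of _ x]) (auto simp: trail_def)
  next
    case False
    with 2 have "trail B x T" "a \<in> attrs T" by (auto simp: trail_def attrs_def)
    from 2(1)[OF this] show ?thesis by auto
  qed
qed (auto simp: attrs_def)

section \<open>Paths of the graph as trails\<close>

lemma is_path_Cons_Cons:
  "is_path V adj (u # x # xs) \<longleftrightarrow>
     u \<in> V \<and> u \<notin> set (x # xs) \<and> adj u x \<and> is_path V adj (x # xs)"
proof -
  have "(\<forall>i. Suc i < length (u # x # xs) \<longrightarrow> adj ((u # x # xs) ! i) ((u # x # xs) ! Suc i)) \<longleftrightarrow>
      adj u x \<and> (\<forall>i. Suc i < length (x # xs) \<longrightarrow> adj ((x # xs) ! i) ((x # xs) ! Suc i))"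
    (is "?l \<longleftrightarrow> ?r")
  proof
    assume l: ?l
    show ?r
    proof (intro conjI allI impI)
      show "adj u x" using l[rule_format, of 0] by simp
      show "adj ((x # xs) ! i) ((x # xs) ! Suc i)" if "Suc i < length (x # xs)" for i
        using l[rule_format, of "Suc i"] that by simp
    qed
  next
    assume r: ?r
    show ?l
    proof (intro allI impI)
      fix i assume "Suc i < length (u # x # xs)"
      with r show "adj ((u # x # xs) ! i) ((u # x # xs) ! Suc i)" by (cases i) auto
    qed
  qed
  then have "is_path V adj (u # x # xs) \<longleftrightarrow> (u # x # xs \<noteq> [] \<and> distinct (u # x # xs) \<and> set (u # x # xs) \<subseteq> V \<and>
      adj u x \<and> (\<forall>i. Suc i < length (x # xs) \<longrightarrow> adj ((x # xs) ! i) ((x # xs) ! Suc i)))"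
    by (simp only: is_path_def)
  also have "\<dots> \<longleftrightarrow> u \<in> V \<and> u \<notin> set (x # xs) \<and> adj u x \<and> is_path V adj (x # xs)"
    unfolding is_path_def distinct.simps list.set by blast
  finally show ?thesis .
qed

text \<open>If the attribute of the first edge reappears later in the trail, one can jump from the start
  directly past that later use; this keeps the attributes of the trail distinct.\<close>

lemma path_imp_trail:
  assumes "is_path V (rig_adj m B) (u # xs)" "xs \<noteq> []"
  shows "\<exists>T. T \<noteq> [] \<and> length T \<le> length xs \<and> snd (last T) = last xs \<and>
    snd ` set T \<subseteq> set xs \<and> attrs T \<subseteq> {..<m} \<and> trail B u T"
  using assms
proof (induction xs arbitrary: u)
  case Nil
  from Nil.prems(2) show ?case by blast
next
  case (Cons x xs)
  from Cons.prems obtain a where a: "a < m" "B (u, a)" "B (x, a)" "u \<noteq> x" and u: "u \<notin> set xs"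
    and path: "is_path V (rig_adj m B) (x # xs)"
    using rig_adj_def[of m B u x] by (auto simp: is_path_Cons_Cons)
  show ?case
  proof (cases "xs = []")
    case True
    with a show ?thesis by (intro exI[of _ "[(a, x)]"]) (auto simp: attrs_def trail_def)
  next
    case False
    from Cons.IH[OF path False] obtain T where T: "T \<noteq> []" "length T \<le> length xs"
      "snd (last T) = last xs" "snd ` set T \<subseteq> set xs" "attrs T \<subseteq> {..<m}" "trail B x T" by blast
    show ?thesis
    proof (cases "a \<in> attrs T")
      case False
      with T a \<open>xs \<noteq> []\<close> show ?thesis
        by (intro exI[of _ "(a, x) # T"]) (auto simp: attrs_def trail_def)
    next
      case True
      then obtain y where "(a, y) \<in> set T" by (auto simp: attrs_def)
      then obtain T1 T2 where T_eq: "T = T1 @ (a, y) # T2" by (meson split_list)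
      have "B (y, a)" "loopless y T2" "\<forall>z\<in>trail_pairs y T2. B z"
        using trail_suffix[of x T1 a y T2 B] T(6) unfolding trail_def T_eq by blast+
      \<comment> \<open>\<open>y\<close> lies on \<open>xs\<close>, and the path never returns to
        \<open>u\<close>; so the new first step is no loop.\<close>
      moreover have "u \<noteq> y" using T(4) u by (auto simp: T_eq)
      ultimately have "trail B u ((a, y) # T2)"
        using a(2) T(6) by (simp add: trail_def T_eq)
      with T(2-5) \<open>xs \<noteq> []\<close> show ?thesis
        by (intro exI[of _ "(a, y) # T2"]) (auto simp: attrs_def T_eq)
    qed
  qed
qed

section \<open>From a shallow minor to trails with disjoint attributes\<close>

lemma set_path_subset:
  assumes "xs \<noteq> []"
  shows "set xs \<subseteq> {hd xs, last xs} \<union> set (inner xs)"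
proof (cases xs)
  case xs: (Cons x ys)
  show ?thesis
  proof (cases ys rule: rev_cases)
    case (snoc zs z)
    then show ?thesis by (auto simp: inner_def xs)
  qed (simp add: xs)
qed (use assms in simp)

text \<open>A maximal independent set dominates \<open>E\<close>, and each of its members accounts
  for at most \<open>d\<close> elements, itself included by reflexivity.\<close>

lemma large_independent_subset:
  fixes E :: "'a set"
  assumes "finite E" "\<And>x y. R x y \<Longrightarrow> R y x" "\<And>x. x \<in> E \<Longrightarrow> R x x"
    "\<And>x. x \<in> E \<Longrightarrow> card {y \<in> E. R x y} \<le> d"
  shows "\<exists>I\<subseteq>E. (\<forall>x\<in>I. \<forall>y\<in>I. x \<noteq> y \<longrightarrow> \<not> R x y) \<and> card E \<le> d * card I"
proof -
  define \<I> where "\<I> = {I. I \<subseteq> E \<and> (\<forall>x\<in>I. \<forall>y\<in>I. x \<noteq> y \<longrightarrow> \<not> R x y)}"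
  have "finite \<I>" using assms(1) by (simp add: \<I>_def)
  moreover have "{} \<in> \<I>" by (simp add: \<I>_def)
  ultimately obtain I where I: "I \<in> \<I>" and max: "\<And>J. J \<in> \<I> \<Longrightarrow> I \<subseteq> J \<Longrightarrow> J = I"
    using finite_has_maximal[of \<I>] by blast
  have "I \<subseteq> E" using I by (simp add: \<I>_def)
  then have "finite I" using assms(1) finite_subset by blast
  have "E \<subseteq> (\<Union>x\<in>I. {y \<in> E. R x y})"
  proof
    fix y assume y: "y \<in> E"
    show "y \<in> (\<Union>x\<in>I. {y \<in> E. R x y})"
    proof (rule ccontr)
      assume no: "\<not> ?thesis"
      then have "\<forall>x\<in>I. \<not> R x y \<and> \<not> R y x" using y assms(2) by blast
      then have "insert y I \<in> \<I>" using I y by (auto simp: \<I>_def)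
      then have "y \<in> I" using max by blast
      with no y assms(3) show False by blast
    qed
  qed
  then have "card E \<le> card (\<Union>x\<in>I. {y \<in> E. R x y})"
    using assms(1) \<open>finite I\<close> by (intro card_mono) auto
  also have "\<dots> \<le> (\<Sum>x\<in>I. card {y \<in> E. R x y})" by (rule card_UN_le) fact
  also have "\<dots> \<le> (\<Sum>x\<in>I. d)" using \<open>I \<subseteq> E\<close> assms(4) by (intro sum_mono) auto
  finally show ?thesis using I by (auto simp: \<I>_def mult.commute)
qed

text \<open>Different trails may share nodes but no attributes. Hence they use different bipartite
  edges, whose presence is independent.\<close>

definition trail_system :: "nat \<Rightarrow> nat \<Rightarrow> nat \<Rightarrow> (nat \<times> nat \<Rightarrow> bool) \<Rightarrow> (nat \<times> nat) set \<Rightarrow>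
    (nat \<times> nat \<Rightarrow> (nat \<times> nat) list) \<Rightarrow> bool" where
  "trail_system n m k B E T \<longleftrightarrow>
     (\<forall>e\<in>E. T e \<in> trails_to n m k (snd e) \<and> trail B (fst e) (T e)) \<and>
     (\<forall>e\<in>E. \<forall>e'\<in>E. e \<noteq> e' \<longrightarrow> attrs (T e) \<inter> attrs (T e') = {})"

text \<open>Used to thin a system to a prescribed number of pairs.\<close>

lemma trail_system_subset:
  assumes "trail_system n m k B E T" "E' \<subseteq> E"
  shows "trail_system n m k B E' T"
  unfolding trail_system_def
proof (intro conjI ballI impI)
  fix e e' assume "e \<in> E'"
  then have e: "e \<in> E" using assms(2) by blast
  then show "T e \<in> trails_to n m k (snd e)" "trail B (fst e) (T e)"
    using assms(1) by (simp_all add: trail_system_def)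
  assume "e' \<in> E'" "e \<noteq> e'"
  moreover from this have "e' \<in> E" using assms(2) by blast
  ultimately show "attrs (T e) \<inter> attrs (T e') = {}"
    using assms(1) e by (simp add: trail_system_def)
qed

lemma shallow_top_minorD:
  assumes "shallow_top_minor V adj k N EH"
  shows "N \<subseteq> V" "EH \<subseteq> {(x, y). x \<in> N \<and> y \<in> N \<and> x < y}"
  by (rule conjunct1[OF assms[unfolded shallow_top_minor_def]],
      rule conjunct1[OF conjunct2[OF assms[unfolded shallow_top_minor_def]]])

text \<open>Paths of a topological minor share nails only, so an attribute with at most \<open>D\<close> nodes is used by
  at most \<open>D\<^sup>2\<close> of them. Hence few paths conflict with a given one, and a maximal conflict-free set
  of paths is large.\<close>

lemma shallow_minor_trail_system:
  assumes minor: "shallow_top_minor {..<n} (rig_adj m B) k N EH"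
    and deg: "\<And>a. a < m \<Longrightarrow> card {u. u < n \<and> B (u, a)} \<le> D"
  shows "\<exists>E\<subseteq>EH. \<exists>T. trail_system n m k B E T \<and> card EH \<le> Suc k * D\<^sup>2 * card E"
proof -
  note minor' = minor[unfolded shallow_top_minor_def]
  note N = shallow_top_minorD(1)[OF minor] and EH = shallow_top_minorD(2)[OF minor]
  obtain P where "(\<forall>e\<in>EH. is_path {..<n} (rig_adj m B) (P e) \<and> hd (P e) = fst e \<and>
      last (P e) = snd e \<and> length (P e) \<le> k + 2 \<and> set (inner (P e)) \<inter> N = {}) \<and>
    (\<forall>e\<in>EH. \<forall>e'\<in>EH. e \<noteq> e' \<longrightarrow> set (inner (P e)) \<inter> set (inner (P e')) = {})"
    using conjunct2[OF conjunct2[OF minor']] by (rule exE)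
  note P' = conjunct1[OF this] and disj' = conjunct2[OF this]
  note P = P'[rule_format] and disj = disj'[rule_format]
  have finEH: "finite EH"
  proof (rule finite_subset)
    show "EH \<subseteq> {..<n} \<times> {..<n}" using EH N by auto
  qed simp
  have "\<exists>T. T \<in> trails_to n m k (snd e) \<and> trail B (fst e) T \<and> insert (fst e) (snd ` set T) \<subseteq> set (P e)"
    if e: "e \<in> EH" for e
  proof -
    have ne: "fst e \<noteq> snd e" using e EH by auto
    have "P e \<noteq> []" using P[OF e] by (simp add: is_path_def)
    then obtain xs where xs: "P e = fst e # xs"
      using P[OF e] by (cases "P e") auto
    with P[OF e] ne have "xs \<noteq> []" by auto
    have path: "is_path {..<n} (rig_adj m B) (fst e # xs)" using P[OF e] xs by simp
    from path_imp_trail[OF path \<open>xs \<noteq> []\<close>] obtain T where T: "T \<noteq> []" "length T \<le> length xs"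
      "snd (last T) = last xs" "snd ` set T \<subseteq> set xs" "attrs T \<subseteq> {..<m}" "trail B (fst e) T" by blast
    have "set xs \<subseteq> {..<n}" using path by (auto simp: is_path_def)
    then have "set T \<subseteq> {..<m} \<times> {..<n}" using T(4,5) by (force simp: attrs_def)
    moreover have "snd (last T) = snd e" using T(3) P[OF e] xs \<open>xs \<noteq> []\<close> by simp
    ultimately have "T \<in> trails_to n m k (snd e)"
      using T P[OF e] xs by (auto simp: trails_to_def)
    with T xs show ?thesis by (intro exI[of _ T]) auto
  qed
  then obtain T where T: "\<And>e. e \<in> EH \<Longrightarrow> T e \<in> trails_to n m k (snd e) \<and> trail B (fst e) (T e) \<and>
      insert (fst e) (snd ` set (T e)) \<subseteq> set (P e)"
    by metis
  have users: "card {e \<in> EH. a \<in> attrs (T e)} \<le> D\<^sup>2" if "a < m" for a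
  proof -
    define A where "A = {u. u < n \<and> B (u, a)}"
    \<comment> \<open>A path that uses \<open>a\<close> is labelled by an ordered pair of distinct
      nodes of \<open>a\<close> lying on it.\<close>
    have "\<exists>xy. fst xy \<noteq> snd xy \<and> xy \<in> A \<times> A \<and> fst xy \<in> set (P e) \<and> snd xy \<in> set (P e)"
      if e: "e \<in> EH" "a \<in> attrs (T e)" for e
    proof -
      have "trail B (fst e) (T e)" using T e by blast
      from trail_attr_cases[OF this e(2)] obtain x y where xy: "x \<noteq> y" "B (x, a)" "B (y, a)"
        "x \<in> set (P e)" "y \<in> set (P e)" using T[OF e(1)] by blast
      moreover have "set (P e) \<subseteq> {..<n}" using P[OF e(1)] by (simp add: is_path_def)
      ultimately show ?thesis by (intro exI[of _ "(x, y)"]) (auto simp: A_def)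
    qed
    then obtain g where g: "\<And>e. e \<in> EH \<Longrightarrow> a \<in> attrs (T e) \<Longrightarrow>
        fst (g e) \<noteq> snd (g e) \<and> g e \<in> A \<times> A \<and> fst (g e) \<in> set (P e) \<and> snd (g e) \<in> set (P e)"
      by metis
    \<comment> \<open>Interiors are disjoint from each other and from the nails, so a common node of
      two paths is an end of both.\<close>
    have nails: "x \<in> {fst e, snd e} \<and> x \<in> {fst e', snd e'}"
      if "e \<in> EH" "e' \<in> EH" "e \<noteq> e'" "x \<in> set (P e)" "x \<in> set (P e')" for e e' x
    proof -
      have "P e \<noteq> []" "P e' \<noteq> []" using P that by (auto simp: is_path_def)
      then have "x \<in> {fst e, snd e} \<union> set (inner (P e))" "x \<in> {fst e', snd e'} \<union> set (inner (P e'))"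
        using set_path_subset[of "P e"] set_path_subset[of "P e'"] P[OF that(1)] P[OF that(2)] that(4,5)
        by (simp_all add: subset_iff)
      moreover have "{fst e, snd e} \<subseteq> N" "{fst e', snd e'} \<subseteq> N" using EH that by auto
      ultimately show ?thesis using P[OF that(1)] P[OF that(2)] disj[OF that(1-3)] by blast
    qed
    \<comment> \<open>Equal labels give two common nodes, hence the same two ends; the order
      \<open>x < y\<close> in \<open>EH\<close> then identifies the edges.\<close>
    have "inj_on g {e \<in> EH. a \<in> attrs (T e)}"
    proof (rule inj_onI, rule ccontr)
      fix e e' assume e: "e \<in> {e \<in> EH. a \<in> attrs (T e)}" "e' \<in> {e \<in> EH. a \<in> attrs (T e)}"
        and eq: "g e = g e'" and ne: "e \<noteq> e'"
      have "fst (g e) \<in> {fst e, snd e} \<and> fst (g e) \<in> {fst e', snd e'}"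
        using nails[of e e' "fst (g e)"] g[of e] g[of e'] e eq ne by simp
      moreover have "snd (g e) \<in> {fst e, snd e} \<and> snd (g e) \<in> {fst e', snd e'}"
        using nails[of e e' "snd (g e)"] g[of e] g[of e'] e eq ne by simp
      moreover have "fst (g e) \<noteq> snd (g e)" using g e by blast
      moreover have "fst e < snd e" "fst e' < snd e'" using EH e by auto
      ultimately have "fst e = fst e' \<and> snd e = snd e'" by auto
      with ne show False by (auto simp: prod_eq_iff)
    qed
    moreover have "g ` {e \<in> EH. a \<in> attrs (T e)} \<subseteq> A \<times> A" using g by blast
    moreover have "finite (A \<times> A)" by (simp add: A_def)
    ultimately have "card {e \<in> EH. a \<in> attrs (T e)} \<le> card (A \<times> A)" by (rule card_inj_on_le)
    also have "\<dots> \<le> D * D"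
      unfolding card_cartesian_product using deg[OF that] by (intro mult_mono) (auto simp: A_def)
    finally show ?thesis by (simp add: power2_eq_square)
  qed
  \<comment> \<open>Two paths conflict when they share an attribute. A path has at most
    \<open>Suc k\<close> attributes, each with at most \<open>D\<^sup>2\<close> users.\<close>
  have "\<exists>I\<subseteq>EH. (\<forall>e\<in>I. \<forall>e'\<in>I. e \<noteq> e' \<longrightarrow> \<not> attrs (T e) \<inter> attrs (T e') \<noteq> {}) \<and>
      card EH \<le> Suc k * D\<^sup>2 * card I"
  proof (rule large_independent_subset[OF finEH])
    show "attrs (T e) \<inter> attrs (T e) \<noteq> {}" if "e \<in> EH" for e
      using T[OF that] by (auto simp: trails_to_def attrs_def)
    fix e assume e: "e \<in> EH"
    have fin: "finite (attrs (T e))" by (simp add: attrs_def)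
    have "card (attrs (T e)) \<le> length (T e)"
      unfolding attrs_def by (metis card_length length_map set_map)
    then have len: "card (attrs (T e)) \<le> Suc k" using T[OF e] by (simp add: trails_to_def)
    have lt: "attrs (T e) \<subseteq> {..<m}" using T[OF e] by (auto simp: trails_to_def attrs_def)
    have "card {e' \<in> EH. attrs (T e) \<inter> attrs (T e') \<noteq> {}} \<le>
        card (\<Union>a\<in>attrs (T e). {e' \<in> EH. a \<in> attrs (T e')})"
      using fin finEH by (intro card_mono) auto
    also have "\<dots> \<le> (\<Sum>a\<in>attrs (T e). card {e' \<in> EH. a \<in> attrs (T e')})"
      by (rule card_UN_le[OF fin])
    also have "\<dots> \<le> (\<Sum>a\<in>attrs (T e). D\<^sup>2)" using lt users by (intro sum_mono) auto
    also have "\<dots> \<le> Suc k * D\<^sup>2" using len by (simp only: sum_constant of_nat_id mult_le_mono1)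
    finally show "card {e' \<in> EH. attrs (T e) \<inter> attrs (T e') \<noteq> {}} \<le> Suc k * D\<^sup>2" .
  qed blast
  then obtain I where I: "I \<subseteq> EH" "\<forall>e\<in>I. \<forall>e'\<in>I. e \<noteq> e' \<longrightarrow> attrs (T e) \<inter> attrs (T e') = {}"
    "card EH \<le> Suc k * D\<^sup>2 * card I" by auto
  have "T e \<in> trails_to n m k (snd e) \<and> trail B (fst e) (T e)" if "e \<in> I" for e
    using T I(1) that by blast
  with I(2) have "trail_system n m k B I T" by (simp add: trail_system_def)
  with I show ?thesis by blast
qed

section \<open>First moment bound\<close>

lemma prob_all_edges:
  assumes p: "p \<in> {0..1}" and S: "S \<subseteq> {..<n} \<times> {..<m}"
  shows "measure_pmf.prob (rand_bip n m p) {B. \<forall>z\<in>S. B z} = p ^ card S"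
proof -
  let ?A = "{..<n} \<times> {..<m}"
  have "{B. \<forall>z\<in>S. B z} = Pi ?A (\<lambda>z. if z \<in> S then {True} else UNIV)"
    using S by (auto simp: Pi_def)
  then have "measure_pmf.prob (rand_bip n m p) {B. \<forall>z\<in>S. B z} =
      (\<Prod>z\<in>?A. measure_pmf.prob (bernoulli_pmf p) (if z \<in> S then {True} else UNIV))"
    by (simp only: rand_bip_def) (rule measure_Pi_pmf_Pi, simp)
  also have "\<dots> = (\<Prod>z\<in>?A. if z \<in> S then p else 1)"
    using p by (intro prod.cong) (auto simp: measure_pmf_single)
  also have "\<dots> = (\<Prod>z\<in>?A \<inter> S. p)" by (simp add: prod.inter_restrict[symmetric])
  also have "?A \<inter> S = S" using S by blast
  finally show ?thesis by simp
qed

lemma prob_UN_le: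
  assumes "finite I"
  shows "measure_pmf.prob M {x. \<exists>i\<in>I. P i x} \<le> (\<Sum>i\<in>I. measure_pmf.prob M {x. P i x})"
proof -
  have "{x. \<exists>i\<in>I. P i x} = (\<Union>i\<in>I. {x. P i x})" by auto
  then show ?thesis
    using measure_pmf.finite_measure_subadditive_finite[OF assms, of "\<lambda>i. {x. P i x}" M] by simp
qed

text \<open>Union bound over an attribute and \<open>d + 1\<close> of its nodes; there are at most
  \<open>n ^ Suc d\<close> such node sets.\<close>

lemma prob_large_attribute_le:
  assumes p: "p \<in> {0..1}"
  shows "measure_pmf.prob (rand_bip n m p) {B. \<exists>a<m. d < card {u. u < n \<and> B (u, a)}}
    \<le> real m * (real n * p) ^ Suc d"
proof -
  define \<S> where "\<S> = {S. S \<subseteq> {..<n} \<and> card S = Suc d}"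
  have fin: "finite \<S>" by (simp add: \<S>_def)
  have "card \<S> = n choose Suc d" by (simp add: \<S>_def n_subsets)
  also have "\<dots> \<le> n ^ Suc d"
    by (cases "Suc d \<le> n") (auto intro: binomial_le_pow simp del: power_Suc simp: binomial_eq_0)
  finally have card: "real (card \<S>) \<le> real n ^ Suc d" by (metis of_nat_le_iff of_nat_power)
  have "measure_pmf.prob (rand_bip n m p) {B. \<exists>a<m. d < card {u. u < n \<and> B (u, a)}}
      \<le> measure_pmf.prob (rand_bip n m p) {B. \<exists>i\<in>{..<m} \<times> \<S>. \<forall>z\<in>snd i \<times> {fst i}. B z}"
  proof (intro measure_pmf.finite_measure_mono subsetI CollectI)
    fix B assume "B \<in> {B. \<exists>a<m. d < card {u. u < n \<and> B (u, a)}}"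
    then obtain a where a: "a < m" "Suc d \<le> card {u. u < n \<and> B (u, a)}" by auto
    from a(2) obtain S where "S \<subseteq> {u. u < n \<and> B (u, a)}" "card S = Suc d"
      by (meson obtain_subset_with_card_n)
    with a(1) show "\<exists>i\<in>{..<m} \<times> \<S>. \<forall>z\<in>snd i \<times> {fst i}. B z"
      by (intro bexI[of _ "(a, S)"]) (auto simp: \<S>_def)
  qed simp
  also have "\<dots> \<le> (\<Sum>i\<in>{..<m} \<times> \<S>. measure_pmf.prob (rand_bip n m p) {B. \<forall>z\<in>snd i \<times> {fst i}. B z})"
    using fin by (intro prob_UN_le) simp
  also have "\<dots> = (\<Sum>i\<in>{..<m} \<times> \<S>. p ^ Suc d)"
  proof (rule sum.cong[OF refl])
    fix i assume "i \<in> {..<m} \<times> \<S>"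
    then have sub: "snd i \<times> {fst i} \<subseteq> {..<n} \<times> {..<m}" and "card (snd i \<times> {fst i}) = Suc d"
      by (auto simp: \<S>_def card_cartesian_product)
    then show "measure_pmf.prob (rand_bip n m p) {B. \<forall>z\<in>snd i \<times> {fst i}. B z} = p ^ Suc d"
      by (simp only: prob_all_edges[OF p sub])
  qed
  also have "\<dots> = real m * real (card \<S>) * p ^ Suc d" by (simp add: card_cartesian_product)
  also have "\<dots> \<le> real m * real n ^ Suc d * p ^ Suc d"
    using card p by (intro mult_right_mono mult_left_mono) auto
  finally show ?thesis by (simp only: power_mult_distrib mult.assoc)
qed

section \<open>Expected number of trails and trail systems\<close>

lemma finite_trails_to: "finite (trails_to n m k v)"
proof (rule finite_subset)
  show "trails_to n m k v \<subseteq> {T. set T \<subseteq> {..<m} \<times> {..<n} \<and> length T \<le> Suc k}"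
    by (auto simp: trails_to_def)
qed (simp add: finite_lists_length_le)

text \<open>There are \<open>(n * m) ^ l * m\<close> step lists of length \<open>l + 1\<close> whose
  last node is \<open>v\<close>. The missing choice of that node is the source of the factor
  \<open>1 / n\<close>.\<close>

lemma sum_trails_to_le:
  assumes p: "p \<ge> 0" and n: "n > 0" and c: "real n * real m * p\<^sup>2 \<le> c"
  shows "(\<Sum>T\<in>trails_to n m k v. p ^ (2 * length T)) \<le> (\<Sum>l\<le>k. c ^ Suc l) / real n"
proof -
  define A where "A = {..<m} \<times> {..<n}"
  define \<L> where "\<L> l = {T. set T \<subseteq> A \<and> length T = l}" for l
  define x where "x = real n * real m * p\<^sup>2"
  have finL: "finite (\<L> l)" for l by (simp add: \<L>_def A_def finite_lists_length_eq)
  have x: "0 \<le> x" "x \<le> c" using c by (auto simp: x_def)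
  \<comment> \<open>The last step is split off because its node is fixed; \<open>l\<close> counts
    the steps before it.\<close>
  have "trails_to n m k v \<subseteq> (\<lambda>(l, T, a). T @ [(a, v)]) ` (SIGMA l:{..k}. \<L> l \<times> {..<m})"
  proof
    fix T assume T: "T \<in> trails_to n m k v"
    then have ne: "T \<noteq> []" and sub: "set T \<subseteq> A" and v: "snd (last T) = v"
      by (simp_all add: trails_to_def A_def)
    have "last T = (fst (last T), v)" using v by (simp add: prod_eq_iff)
    then have T_eq: "T = butlast T @ [(fst (last T), v)]"
      using append_butlast_last_id[OF ne] by simp
    have "last T \<in> A" using sub ne by auto
    have "set (butlast T) \<subseteq> A" using sub in_set_butlastD by fastforce
    moreover have "fst (last T) < m" using \<open>last T \<in> A\<close> by (auto simp: A_def)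
    moreover have "length T - 1 \<le> k" using T by (auto simp: trails_to_def)
    ultimately have "(length T - 1, butlast T, fst (last T)) \<in> (SIGMA l:{..k}. \<L> l \<times> {..<m})"
      by (simp add: \<L>_def)
    moreover have "T = (\<lambda>(l, T, a). T @ [(a, v)]) (length T - 1, butlast T, fst (last T))"
      using T_eq by simp
    ultimately show "T \<in> (\<lambda>(l, T, a). T @ [(a, v)]) ` (SIGMA l:{..k}. \<L> l \<times> {..<m})"
      by (rule rev_image_eqI)
  qed
  then have "(\<Sum>T\<in>trails_to n m k v. p ^ (2 * length T))
      \<le> (\<Sum>T\<in>(\<lambda>(l, T, a). T @ [(a, v)]) ` (SIGMA l:{..k}. \<L> l \<times> {..<m}). p ^ (2 * length T))"
    using p finL by (intro sum_mono2) auto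
  also have "\<dots> \<le> (\<Sum>(l, T, a)\<in>(SIGMA l:{..k}. \<L> l \<times> {..<m}). p ^ (2 * length (T @ [(a, v)])))"
    using p finL by (intro order_trans[OF sum_image_le]) (auto simp: case_prod_unfold)
  also have "\<dots> = (\<Sum>l\<le>k. \<Sum>(T, a)\<in>\<L> l \<times> {..<m}. p ^ (2 * length (T @ [(a, v)])))"
    using finL by (subst sum.Sigma) (auto simp: case_prod_unfold)
  also have "\<dots> = (\<Sum>l\<le>k. x ^ Suc l / real n)"
  proof (rule sum.cong[OF refl])
    fix l assume "l \<in> {..k}"
    have "(\<Sum>(T, a)\<in>\<L> l \<times> {..<m}. p ^ (2 * length (T @ [(a, v)]))) = (\<Sum>z\<in>\<L> l \<times> {..<m}. p ^ (2 * Suc l))"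
      by (rule sum.cong) (auto simp: \<L>_def)
    also have "\<dots> = real (card (\<L> l)) * real m * p ^ (2 * Suc l)"
      by (simp add: card_cartesian_product)
    also have "card (\<L> l) = (m * n) ^ l"
      by (simp add: \<L>_def A_def card_lists_length_eq card_cartesian_product)
    also have "real ((m * n) ^ l) * real m * p ^ (2 * Suc l) = x ^ Suc l / real n"
      using n by (simp add: x_def power_mult power_mult_distrib field_simps power2_eq_square)
    finally show "(\<Sum>(T, a)\<in>\<L> l \<times> {..<m}. p ^ (2 * length (T @ [(a, v)]))) = x ^ Suc l / real n" .
  qed
  also have "\<dots> \<le> (\<Sum>l\<le>k. c ^ Suc l / real n)"
    using x by (intro sum_mono divide_right_mono power_mono) auto
  finally show ?thesis by (simp add: sum_divide_distrib)
qed

text \<open>The trails of a system use pairwise distinct bipartite edges, two for each step, and all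
  of them have to be present.\<close>

lemma prob_fixed_trail_system_le:
  assumes p: "p \<in> {0..1}" and E: "finite E" "E \<subseteq> {..<n} \<times> {..<n}"
    and T: "\<And>e. e \<in> E \<Longrightarrow> T e \<in> trails_to n m k (snd e)"
  shows "measure_pmf.prob (rand_bip n m p) {B. trail_system n m k B E T} \<le> (\<Prod>e\<in>E. p ^ (2 * length (T e)))"
\<comment> \<open>Looplessness and distinctness of attributes do not depend on \<open>B\<close>:
  either some \<open>B0\<close> certifies them, or the event is empty.\<close>
proof (cases "\<exists>B. trail_system n m k B E T")
  case True
  then obtain B0 where B0: "trail_system n m k B0 E T" by blast
  define S where "S = (\<Union>e\<in>E. trail_pairs (fst e) (T e))"
  have "measure_pmf.prob (rand_bip n m p) {B. trail_system n m k B E T} \<le>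
      measure_pmf.prob (rand_bip n m p) {B. \<forall>z\<in>S. B z}"
    by (intro measure_pmf.finite_measure_mono) (auto simp: S_def trail_system_def trail_def)
  also have "\<dots> = p ^ card S"
  proof (intro prob_all_edges p)
    have "trail_pairs (fst e) (T e) \<subseteq> {..<n} \<times> {..<m}" if "e \<in> E" for e
      using T[OF that] E(2) that by (intro trail_pairs_subset) (auto simp: trails_to_def)
    then show "S \<subseteq> {..<n} \<times> {..<m}" unfolding S_def by blast
  qed
  also have "card S = (\<Sum>e\<in>E. card (trail_pairs (fst e) (T e)))"
    unfolding S_def
  proof (intro card_UN_disjoint E(1) ballI impI)
    fix e assume "e \<in> E"
    have "finite (trail_pairs u xs)" for u xs by (induction u xs rule: trail_pairs.induct) auto
    then show "finite (trail_pairs (fst e) (T e))" .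
  next
    fix e e' assume "e \<in> E" "e' \<in> E" "e \<noteq> e'"
    then have "attrs (T e) \<inter> attrs (T e') = {}" using B0 by (simp add: trail_system_def)
    then show "trail_pairs (fst e) (T e) \<inter> trail_pairs (fst e') (T e') = {}"
      unfolding snd_trail_pairs[of "fst e" "T e", symmetric] snd_trail_pairs[of "fst e'" "T e'", symmetric]
      by blast
  qed
  also have "\<dots> = (\<Sum>e\<in>E. 2 * length (T e))"
    using B0 by (intro sum.cong card_trail_pairs) (auto simp: trail_system_def trail_def)
  also have "p ^ \<dots> = (\<Prod>e\<in>E. p ^ (2 * length (T e)))" by (rule power_sum)
  finally show ?thesis .
next
  case False
  then have "measure_pmf.prob (rand_bip n m p) {B. trail_system n m k B E T} = 0" by simp
  also have "\<dots> \<le> (\<Prod>e\<in>E. p ^ (2 * length (T e)))" using p by (intro prod_nonneg) auto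
  finally show ?thesis .
qed

text \<open>Union bound over all choices of one trail for each pair. The sum of products over the
  choices is a product of sums, each bounded by \<open>sum_trails_to_le\<close>.\<close>

lemma prob_trail_system_le:
  assumes p: "p \<in> {0..1}" and n: "n > 0" and c: "real n * real m * p\<^sup>2 \<le> c"
    and E: "finite E" "E \<subseteq> {..<n} \<times> {..<n}"
  shows "measure_pmf.prob (rand_bip n m p) {B. \<exists>T. trail_system n m k B E T}
    \<le> ((\<Sum>l\<le>k. c ^ Suc l) / real n) ^ card E"
proof -
  define \<T> where "\<T> = PiE E (\<lambda>e. trails_to n m k (snd e))"
  have "measure_pmf.prob (rand_bip n m p) {B. \<exists>T. trail_system n m k B E T}
      \<le> measure_pmf.prob (rand_bip n m p) {B. \<exists>T\<in>\<T>. trail_system n m k B E T}"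
  proof (intro measure_pmf.finite_measure_mono subsetI CollectI)
    fix B assume "B \<in> {B. \<exists>T. trail_system n m k B E T}"
    then obtain T where T: "trail_system n m k B E T" by blast
    \<comment> \<open>Restriction to \<open>E\<close> turns the choice into a member of a finite
      product set.\<close>
    then have "trail_system n m k B E (restrict T E)" by (simp add: trail_system_def)
    moreover have "restrict T E \<in> \<T>" using T by (simp add: \<T>_def trail_system_def)
    ultimately show "\<exists>T\<in>\<T>. trail_system n m k B E T" by blast
  qed simp
  also have "\<dots> \<le> (\<Sum>T\<in>\<T>. measure_pmf.prob (rand_bip n m p) {B. trail_system n m k B E T})"
    unfolding \<T>_def using E finite_trails_to by (intro prob_UN_le finite_PiE)
  also have "\<dots> \<le> (\<Sum>T\<in>\<T>. \<Prod>e\<in>E. p ^ (2 * length (T e)))"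
    by (intro sum_mono prob_fixed_trail_system_le[OF p E]) (auto simp: \<T>_def)
  also have "\<dots> = (\<Prod>e\<in>E. \<Sum>T\<in>trails_to n m k (snd e). p ^ (2 * length T))"
    unfolding \<T>_def using E finite_trails_to by (intro prod_sum_PiE[symmetric])
  also have "\<dots> \<le> (\<Prod>e\<in>E. (\<Sum>l\<le>k. c ^ Suc l) / real n)"
    using p by (intro prod_mono conjI sum_nonneg sum_trails_to_le n c) auto
  finally show ?thesis by simp
qed

text \<open>The term of index \<open>b\<close> in the series of \<open>exp b\<close> is at most the
  whole sum, which bounds \<open>fact b\<close> from below by
  \<open>(b / exp 1) ^ b\<close>.\<close>

lemma binomial_le_exp_pow:
  assumes "b > 0"
  shows "real (a choose b) \<le> (exp 1 * real a / real b) ^ b"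
proof -
  have "real b ^ b / fact b \<le> exp (real b)"
  proof -
    have "(\<Sum>i\<in>{b}. real b ^ i / fact i) \<le> (\<Sum>i. real b ^ i / fact i)"
      using summable_exp_generic[of "real b"]
      by (intro sum_le_suminf) (auto simp: divide_inverse mult.commute)
    then show ?thesis by (simp add: exp_def divide_inverse mult.commute)
  qed
  then have "1 / fact b \<le> (exp 1 / real b) ^ b"
    using assms by (simp add: field_simps power_divide flip: exp_of_nat_mult)
  then have *: "real a ^ b * (1 / fact b) \<le> real a ^ b * (exp 1 / real b) ^ b"
    by (intro mult_left_mono) auto
  have "real (a choose b) \<le> real a ^ b / fact b"
  proof -
    have "real (a choose b) * fact b = real ((a choose b) * fact b)" by simp
    also have "(a choose b) * fact b \<le> a ^ b"
    proof (cases "b \<le> a")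
      case True
      then have "(a choose b) * fact b = fact a div fact (a - b)"
        by (metis binomial_fact_lemma fact_nonzero mult.commute nonzero_mult_div_cancel_left mult.assoc)
      also have "\<dots> \<le> a ^ b" using True by (rule fact_div_fact_le_pow)
      finally show ?thesis .
    qed (simp add: binomial_eq_0)
    then have "real ((a choose b) * fact b) \<le> real a ^ b" by (metis of_nat_le_iff of_nat_power)
    finally show ?thesis by (simp add: field_simps)
  qed
  with * show ?thesis by (simp add: power_mult_distrib mult.commute power_divide)
qed

text \<open>With \<open>r = s / n\<close> and \<open>y = exp 1 * K / F\<close>, the term is at most
  \<open>(exp 1 / r * (y * r) ^ F) ^ s\<close>. Since \<open>F >= 2\<close> and
  \<open>y <= 1 / 4\<close>, the base is at most \<open>exp 1 / 16 * r\<close>, and hence at most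
  \<open>r / 4\<close>.\<close>

lemma first_moment_term_le:
  assumes s: "0 < s" "s \<le> n" and F: "F \<ge> 2" "real F \<ge> 4 * exp 1 * K" and K: "K \<ge> 0"
  shows "real (n choose s) * real (s\<^sup>2 choose (F * s)) * (K / real n) ^ (F * s) \<le> (1 / 2) ^ s / real n"
proof -
  define r where "r = real s / real n"
  define y where "y = exp 1 * K / real F"
  have r: "0 < r" "r \<le> 1" using s by (auto simp: r_def)
  have y: "0 \<le> y" "y \<le> 1 / 4" using F K by (auto simp: y_def field_simps)
  have "real (s\<^sup>2 choose (F * s)) \<le> (exp 1 * real (s\<^sup>2) / real (F * s)) ^ (F * s)"
    using s F by (intro binomial_le_exp_pow) auto
  also have "exp 1 * real (s\<^sup>2) / real (F * s) = exp 1 * real s / real F"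
    using s by (simp add: power2_eq_square)
  finally have "real (n choose s) * real (s\<^sup>2 choose (F * s)) * (K / real n) ^ (F * s)
      \<le> (exp 1 * real n / real s) ^ s * (exp 1 * real s / real F) ^ (F * s) * (K / real n) ^ (F * s)"
    using s K by (intro mult_mono binomial_le_exp_pow) auto
  also have "\<dots> = (exp 1 / r) ^ s * ((exp 1 * real s / real F) * (K / real n)) ^ (F * s)"
    by (simp only: power_mult_distrib r_def) (simp add: mult.assoc)
  also have "(exp 1 * real s / real F) * (K / real n) = y * r" by (simp add: y_def r_def)
  also have "(exp 1 / r) ^ s * (y * r) ^ (F * s) = (exp 1 / r * (y * r) ^ F) ^ s"
    by (subst power_mult) (rule power_mult_distrib[symmetric])
  also have "\<dots> \<le> (r / 4) ^ s"
  proof (rule power_mono)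
    have "(y * r) ^ F \<le> (y * r) ^ 2"
      using F y r by (intro power_decreasing) (auto intro: mult_le_one)
    also have "\<dots> = y\<^sup>2 * r\<^sup>2" by (rule power_mult_distrib)
    also have "\<dots> \<le> (1 / 4)\<^sup>2 * r\<^sup>2" using y by (intro mult_right_mono power_mono) auto
    finally have "exp 1 / r * (y * r) ^ F \<le> exp 1 / r * ((1 / 4)\<^sup>2 * r\<^sup>2)"
      using r by (intro mult_left_mono) auto
    also have "\<dots> = exp 1 / 16 * r" using r by (simp add: power2_eq_square)
    also have "\<dots> \<le> 1 / 4 * r" using exp_le r by (intro mult_right_mono) auto
    finally show "exp 1 / r * (y * r) ^ F \<le> r / 4" by simp
  qed (use r y in auto)
  also have "\<dots> = r ^ s * (1 / 4) ^ s" by (simp add: power_divide)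
  \<comment> \<open>One factor \<open>r = s / n\<close> is kept for the decay in \<open>n\<close>;
    its numerator is absorbed by \<open>s <= 2 ^ s\<close>.\<close>
  also have "\<dots> \<le> r ^ 1 * (1 / 4) ^ s"
    using r s by (intro mult_right_mono power_decreasing) auto
  also have "\<dots> = (real s * (1 / 4) ^ s) / real n" by (simp add: r_def)
  also have "\<dots> \<le> (2 ^ s * (1 / 4) ^ s) / real n"
    using less_imp_le[OF of_nat_less_two_power[of s, where 'a = real]]
    by (intro divide_right_mono mult_right_mono) auto
  also have "(2::real) ^ s * (1 / 4) ^ s = (1 / 2) ^ s" by (simp flip: power_mult_distrib)
  finally show ?thesis .
qed

text \<open>Equality in the number of pairs leaves a single size of \<open>E\<close> for each
  \<open>N\<close> in the union bound; larger systems are thinned to it.\<close>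

definition dense_trail_system :: "nat \<Rightarrow> nat \<Rightarrow> nat \<Rightarrow> nat \<Rightarrow> (nat \<times> nat \<Rightarrow> bool) \<Rightarrow> bool" where
  "dense_trail_system n m k F B \<longleftrightarrow> (\<exists>N E. N \<subseteq> {..<n} \<and> N \<noteq> {} \<and> E \<subseteq> N \<times> N \<and>
     card E = F * card N \<and> (\<exists>T. trail_system n m k B E T))"

text \<open>Union bound over nail sets of size \<open>s\<close> and over sets of exactly \<open>F s\<close> pairs of nails. The factor
  \<open>1 / n\<close> per pair beats the number of choices once \<open>F\<close> is a large constant.\<close>

lemma prob_dense_trail_system_le:
  assumes p: "p \<in> {0..1}" and n: "n > 0" and c: "real n * real m * p\<^sup>2 \<le> c"
    and F: "F \<ge> 2" "real F \<ge> 4 * exp 1 * (\<Sum>l\<le>k. c ^ Suc l)"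
  shows "measure_pmf.prob (rand_bip n m p) {B. dense_trail_system n m k F B} \<le> 1 / real n"
proof -
  define K where "K = (\<Sum>l\<le>k. c ^ Suc l)"
  have "0 \<le> c" using c by (rule order_trans[rotated]) auto
  then have K: "K \<ge> 0" by (auto simp: K_def intro!: sum_nonneg)
  define \<N> where "\<N> s = {N. N \<subseteq> {..<n} \<and> card N = s}" for s
  define \<E> where "\<E> N = {E. E \<subseteq> N \<times> N \<and> card E = F * card N}" for N :: "nat set"
  have fN: "finite (\<N> s)" for s by (simp add: \<N>_def)
  have fin: "finite N" if "N \<in> \<N> s" for N s using that by (auto simp: \<N>_def intro: finite_subset)
  have fE: "finite (\<E> N)" if "N \<in> \<N> s" for N s using fin[OF that] by (simp add: \<E>_def)
  let ?P = "\<lambda>E. measure_pmf.prob (rand_bip n m p) {B. \<exists>T. trail_system n m k B E T}"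
  have "measure_pmf.prob (rand_bip n m p) {B. dense_trail_system n m k F B}
      \<le> measure_pmf.prob (rand_bip n m p)
        {B. \<exists>s\<in>{1..n}. \<exists>N\<in>\<N> s. \<exists>E\<in>\<E> N. \<exists>T. trail_system n m k B E T}"
  proof (intro measure_pmf.finite_measure_mono subsetI CollectI)
    fix B assume "B \<in> {B. dense_trail_system n m k F B}"
    then obtain N E where NE: "N \<subseteq> {..<n}" "N \<noteq> {}" "E \<subseteq> N \<times> N" "card E = F * card N"
      "\<exists>T. trail_system n m k B E T" unfolding dense_trail_system_def by blast
    have "finite N" using NE finite_subset by blast
    then have "card N \<in> {1..n}"
      using NE card_mono[of "{..<n}" N] by (auto simp: Suc_le_eq card_gt_0_iff)
    moreover have "N \<in> \<N> (card N)" "E \<in> \<E> N" using NE by (auto simp: \<N>_def \<E>_def)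
    ultimately show "\<exists>s\<in>{1..n}. \<exists>N\<in>\<N> s. \<exists>E\<in>\<E> N. \<exists>T. trail_system n m k B E T"
      using NE(5) by blast
  qed simp
  also have "\<dots> \<le> (\<Sum>s\<in>{1..n}. measure_pmf.prob (rand_bip n m p)
        {B. \<exists>N\<in>\<N> s. \<exists>E\<in>\<E> N. \<exists>T. trail_system n m k B E T})"
    by (rule prob_UN_le) simp
  also have "\<dots> \<le> (\<Sum>s\<in>{1..n}. \<Sum>N\<in>\<N> s. measure_pmf.prob (rand_bip n m p)
        {B. \<exists>E\<in>\<E> N. \<exists>T. trail_system n m k B E T})"
    by (intro sum_mono prob_UN_le fN)
  also have "\<dots> \<le> (\<Sum>s\<in>{1..n}. \<Sum>N\<in>\<N> s. \<Sum>E\<in>\<E> N. ?P E)"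
    by (intro sum_mono prob_UN_le fE)
  also have "\<dots> \<le> (\<Sum>s\<in>{1..n}. \<Sum>N\<in>\<N> s. \<Sum>E\<in>\<E> N. (K / real n) ^ (F * s))"
  proof (intro sum_mono)
    fix s N E assume N: "N \<in> \<N> s" and E: "E \<in> \<E> N"
    have "finite E" using E fin[OF N] by (auto simp: \<E>_def intro: finite_subset)
    moreover have "E \<subseteq> {..<n} \<times> {..<n}" using N E by (auto simp: \<N>_def \<E>_def)
    moreover have "card E = F * s" using N E by (simp add: \<N>_def \<E>_def)
    ultimately show "?P E \<le> (K / real n) ^ (F * s)"
      using prob_trail_system_le[OF p n c, of E k] by (simp add: K_def)
  qed
  also have "\<dots> = (\<Sum>s\<in>{1..n}. real (n choose s) * real (s\<^sup>2 choose (F * s)) * (K / real n) ^ (F * s))"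
  proof (rule sum.cong[OF refl])
    fix s
    have "card (\<E> N) = s\<^sup>2 choose (F * s)" if "N \<in> \<N> s" for N
      using fin[OF that] that n_subsets[of "N \<times> N" "F * s"]
      by (simp add: \<E>_def \<N>_def card_cartesian_product power2_eq_square)
    then have "(\<Sum>N\<in>\<N> s. \<Sum>E\<in>\<E> N. (K / real n) ^ (F * s)) =
        (\<Sum>N\<in>\<N> s. real (s\<^sup>2 choose (F * s)) * (K / real n) ^ (F * s))" by simp
    also have "\<dots> = real (card (\<N> s)) * real (s\<^sup>2 choose (F * s)) * (K / real n) ^ (F * s)" by simp
    also have "card (\<N> s) = n choose s" by (simp add: \<N>_def n_subsets)
    finally show "(\<Sum>N\<in>\<N> s. \<Sum>E\<in>\<E> N. (K / real n) ^ (F * s)) =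
      real (n choose s) * real (s\<^sup>2 choose (F * s)) * (K / real n) ^ (F * s)" .
  qed
  also have "\<dots> \<le> (\<Sum>s\<in>{1..n}. (1 / 2) ^ s / real n)"
    using F K by (intro sum_mono first_moment_term_le) (auto simp: K_def)
  also have "\<dots> = (\<Sum>s\<in>{1..n}. (1 / 2) ^ s) / real n" by (simp add: sum_divide_distrib)
  also have "(\<Sum>s\<in>{1..n}. (1 / 2 :: real) ^ s) = 1 - (1 / 2) ^ n" by (induction n) auto
  also have "(1 - (1 / 2) ^ n) / real n \<le> 1 / real n" by (intro divide_right_mono) auto
  finally show ?thesis .
qed

section \<open>Bounded expansion\<close>

text \<open>By \<open>shallow_minor_trail_system\<close>, a denser minor would yield a trail system
  on more than \<open>F * card N\<close> pairs of its nails, and thinning that system contradicts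
  \<open>sparse\<close>.\<close>

lemma tgrad_le:
  assumes deg: "\<And>a. a < m \<Longrightarrow> card {u. u < n \<and> B (u, a)} \<le> D"
    and sparse: "\<not> dense_trail_system n m k F B"
  shows "tgrad {..<n} (rig_adj m B) k \<le> real (F * (Suc k * D\<^sup>2))"
  unfolding tgrad_def
proof (rule cSup_least)
  fix x
  assume "x \<in> insert 0 {real (card EH) / real (card N) | N EH.
      shallow_top_minor {..<n} (rig_adj m B) k N EH \<and> N \<noteq> {}}"
  then consider "x = 0" | N EH where "x = real (card EH) / real (card N)"
    "shallow_top_minor {..<n} (rig_adj m B) k N EH" "N \<noteq> {}" by blast
  then show "x \<le> real (F * (Suc k * D\<^sup>2))"
  proof cases
    case 2
    have N: "N \<subseteq> {..<n}" and EH: "EH \<subseteq> {(x, y). x \<in> N \<and> y \<in> N \<and> x < y}"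
      using shallow_top_minorD[OF 2(2)] by auto
    have "finite N" using N finite_subset by blast
    have "card EH \<le> F * (Suc k * D\<^sup>2) * card N"
    proof (rule ccontr)
      assume contr: "\<not> card EH \<le> F * (Suc k * D\<^sup>2) * card N"
      obtain E T where E: "E \<subseteq> EH" and T: "trail_system n m k B E T"
        and card: "card EH \<le> Suc k * D\<^sup>2 * card E"
        using shallow_minor_trail_system[OF 2(2) deg] by blast
      from contr have "F * (Suc k * D\<^sup>2) * card N < card EH" by (simp only: not_le)
      also note card
      finally have "Suc k * D\<^sup>2 * (F * card N) < Suc k * D\<^sup>2 * card E"
        by (simp only: mult_ac)
      then have "F * card N \<le> card E" unfolding mult_less_cancel1 by simp
      then obtain E' where E': "E' \<subseteq> E" "card E' = F * card N"
        by (meson obtain_subset_with_card_n)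
      have "trail_system n m k B E' T" using T E'(1) by (rule trail_system_subset)
      moreover have "E' \<subseteq> N \<times> N" using E E' EH by auto
      ultimately have "dense_trail_system n m k F B"
        unfolding dense_trail_system_def using N 2(3) E'(2) by blast
      with sparse show False by contradiction
    qed
    then have "real (card EH) \<le> real (F * (Suc k * D\<^sup>2)) * real (card N)"
      by (simp only: of_nat_le_iff flip: of_nat_mult)
    moreover have "real (card N) > 0" using \<open>finite N\<close> 2(3) by (simp add: card_gt_0_iff)
    ultimately show ?thesis unfolding 2(1) by (simp only: pos_divide_le_eq)
  qed simp
qed simp

text \<open>Over a finite \<open>V\<close> there are only finitely many pairs
  \<open>(N, EH)\<close>, so the supremum is taken over a bounded set.\<close>

lemma density_le_tgrad:
  assumes V: "finite V" and minor: "shallow_top_minor V adj k N EH" and "N \<noteq> {}"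
  shows "real (card EH) / real (card N) \<le> tgrad V adj k"
  unfolding tgrad_def
proof (rule cSup_upper)
  let ?X = "{real (card EH) / real (card N) | N EH. shallow_top_minor V adj k N EH \<and> N \<noteq> {}}"
  show "real (card EH) / real (card N) \<in> insert 0 ?X" using minor \<open>N \<noteq> {}\<close> by blast
  have "?X \<subseteq> (\<lambda>(N, EH). real (card EH) / real (card N)) ` (Pow V \<times> Pow (V \<times> V))"
  proof
    fix x assume "x \<in> ?X"
    then obtain N EH where x: "x = real (card EH) / real (card N)"
      and m: "shallow_top_minor V adj k N EH" by blast
    have "N \<subseteq> V" "EH \<subseteq> {(x, y). x \<in> N \<and> y \<in> N \<and> x < y}"
      using shallow_top_minorD[OF m] by auto
    then have "(N, EH) \<in> Pow V \<times> Pow (V \<times> V)" by auto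
    then show "x \<in> (\<lambda>(N, EH). real (card EH) / real (card N)) ` (Pow V \<times> Pow (V \<times> V))"
      by (rule rev_image_eqI) (simp add: x)
  qed
  then have "finite ?X" by (rule finite_subset) (use V in simp)
  then show "bdd_above (insert 0 ?X)" by (intro bdd_above_finite) simp
qed

text \<open>The subgraph induced on a set \<open>S\<close> attaining the degeneracy is itself a
  minor of every depth, and its degree sum is twice its number of edges.\<close>

lemma degeneracy_le_tgrad:
  assumes V: "finite V" "V \<noteq> {}" and sym: "\<And>x y. adj x y \<Longrightarrow> adj y x" and irrefl: "\<And>x. \<not> adj x x"
  shows "real (degeneracy V adj) \<le> 2 * tgrad V adj k"
proof -
  have "degeneracy V adj \<in> {Min ((\<lambda>v. card {u \<in> S. adj v u}) ` S) | S. S \<subseteq> V \<and> S \<noteq> {}}"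
    unfolding degeneracy_def using V by (intro Max_in finite_min_degrees) auto
  then obtain S where S: "S \<subseteq> V" "S \<noteq> {}"
    and d: "degeneracy V adj = Min ((\<lambda>v. card {u \<in> S. adj v u}) ` S)" by blast
  have fin: "finite S" using S V finite_subset by blast
  define EH where "EH = {(x, y). x \<in> S \<and> y \<in> S \<and> x < y \<and> adj x y}"
  have finEH: "finite EH" by (rule finite_subset[of _ "S \<times> S"]) (use fin in \<open>auto simp: EH_def\<close>)
  have "card S * degeneracy V adj = (\<Sum>v\<in>S. degeneracy V adj)" by simp
  also have "\<dots> \<le> (\<Sum>v\<in>S. card {u \<in> S. adj v u})"
    unfolding d using fin by (intro sum_mono Min_le) auto
  also have "\<dots> = card (SIGMA v:S. {u \<in> S. adj v u})"
    using fin by (intro card_SigmaI[symmetric]) auto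
  \<comment> \<open>The ordered adjacent pairs are the edges in \<open>EH\<close> in both
    orientations.\<close>
  also have "(SIGMA v:S. {u \<in> S. adj v u}) = EH \<union> prod.swap ` EH"
  proof (intro equalityI subsetI)
    fix z assume z: "z \<in> (SIGMA v:S. {u \<in> S. adj v u})"
    obtain x y where xy: "z = (x, y)" by (cases z)
    with z have "x \<in> S" "y \<in> S" "adj x y" "x \<noteq> y" using irrefl by auto
    then show "z \<in> EH \<union> prod.swap ` EH"
      using sym[of x y] by (cases "x < y") (auto simp: xy EH_def image_iff)
  qed (use sym in \<open>auto simp: EH_def\<close>)
  also have "card \<dots> \<le> card EH + card (prod.swap ` EH)" by (rule card_Un_le)
  also have "card (prod.swap ` EH) \<le> card EH" by (rule card_image_le[OF finEH])
  finally have "card S * degeneracy V adj \<le> 2 * card EH" by simp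
  then have "real (card S * degeneracy V adj) \<le> real (2 * card EH)" by (simp only: of_nat_le_iff)
  moreover have "real (card S) > 0" using fin S by (simp add: card_gt_0_iff)
  ultimately have "real (degeneracy V adj) \<le> 2 * (real (card EH) / real (card S))"
    by (simp add: field_simps)
  also have "shallow_top_minor V adj k S EH"
    using S by (intro edges_shallow_top_minor) (auto simp: EH_def)
  then have "2 * (real (card EH) / real (card S)) \<le> 2 * tgrad V adj k"
    using density_le_tgrad[OF V(1) _ S(2)] by (intro mult_left_mono) auto
  finally show ?thesis .
qed

lemma sparse_regime:
  fixes \<alpha> \<beta> \<gamma> :: real
  assumes "\<beta> > 0" "\<gamma> > 0" "\<alpha> > 1"
  defines "G \<equiv> (\<lambda>n::nat. RIG n (nat \<lfloor>\<beta> * real n powr \<alpha>\<rfloor>) (\<gamma> * real n powr (-(1 + \<alpha>) / 2)))"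
  shows "bounded_expansion G"
    and "\<exists>C. whp G (\<lambda>n adj. real (degeneracy {..<n} adj) \<le> C)"
proof -
  define m where "m n = nat \<lfloor>\<beta> * real n powr \<alpha>\<rfloor>" for n :: nat
  define p where "p n = \<gamma> * real n powr (-(1 + \<alpha>) / 2)" for n :: nat
  \<comment> \<open>The bound for \<open>n * m * p\<^sup>2\<close>, in which the powers of
    \<open>n\<close> cancel.\<close>
  define c where "c = \<beta> * \<gamma>\<^sup>2"
  \<comment> \<open>The expected number of attributes together with \<open>D + 1\<close> of their
    nodes is at most of order n to the power \<alpha> + (D + 1) (1 - \<alpha>) / 2. This exponent is
    negative once \<open>D + 1\<close> exceeds 2 \<alpha> / (\<alpha> - 1).\<close>
  define D where "D = nat \<lceil>2 * \<alpha> / (\<alpha> - 1)\<rceil>"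
  \<comment> \<open>The least integer that meets both conditions of
    \<open>prob_dense_trail_system_le\<close>.\<close>
  define F where "F k = nat \<lceil>max 2 (4 * exp 1 * (\<Sum>l\<le>k. c ^ Suc l))\<rceil>" for k :: nat
  define f where "f k = F k * (Suc k * D\<^sup>2)" for k
  define good where "good k n B \<longleftrightarrow> (\<forall>a<m n. card {u. u < n \<and> B (u, a)} \<le> D) \<and>
      \<not> dense_trail_system n (m n) k (F k) B" for k n and B :: "nat \<times> nat \<Rightarrow> bool"
  have G: "G = (\<lambda>n. RIG n (m n) (p n))" by (simp add: G_def m_def p_def)
  have p01: "\<forall>\<^sub>F n in sequentially. p n \<in> {0..1}"
    unfolding p_def using assms by (intro edge_probability_in_unit) auto
  have m_le: "real (m n) \<le> \<beta> * real n powr \<alpha>" for n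
    unfolding m_def using assms by (intro floor_nat_bounds) auto
  have F: "F k \<ge> 2" "real (F k) \<ge> 4 * exp 1 * (\<Sum>l\<le>k. c ^ Suc l)" for k
  proof -
    have "max 2 (4 * exp 1 * (\<Sum>l\<le>k. c ^ Suc l)) \<le> real (F k)"
      unfolding F_def by (rule real_nat_ceiling_ge)
    then have "2 \<le> real (F k)" "4 * exp 1 * (\<Sum>l\<le>k. c ^ Suc l) \<le> real (F k)" by linarith+
    then show "F k \<ge> 2" "real (F k) \<ge> 4 * exp 1 * (\<Sum>l\<le>k. c ^ Suc l)" by simp_all
  qed
  have c: "real n * real (m n) * (p n)\<^sup>2 \<le> c" if "n > 0" for n
  proof -
    have "real n * real (m n) * (p n)\<^sup>2 \<le> real n * (\<beta> * real n powr \<alpha>) * (p n)\<^sup>2"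
      using m_le by (intro mult_right_mono mult_left_mono) auto
    also have "\<dots> = c * (real n powr 1 * real n powr \<alpha> *
        (real n powr (-(1 + \<alpha>) / 2) * real n powr (-(1 + \<alpha>) / 2)))"
      using that by (simp add: c_def p_def power2_eq_square)
    also have "real n powr 1 * real n powr \<alpha> *
        (real n powr (-(1 + \<alpha>) / 2) * real n powr (-(1 + \<alpha>) / 2)) = real n powr 0"
      by (simp only: powr_add[symmetric]) (simp add: field_simps)
    finally show ?thesis using that by simp
  qed
  have large: "(\<lambda>n. real (m n) * (real n * p n) ^ Suc D) \<longlonglongrightarrow> 0"
  proof -
    have D: "real D \<ge> 2 * \<alpha> / (\<alpha> - 1)" unfolding D_def by (rule real_nat_ceiling_ge)
    define \<theta> where "\<theta> = \<alpha> + real (Suc D) * ((1 - \<alpha>) / 2)"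
    have "2 * \<alpha> / (\<alpha> - 1) < real (Suc D)" using D by simp
    then have "\<theta> < 0" using assms by (simp add: \<theta>_def field_simps)
    then have lim: "(\<lambda>n. \<beta> * \<gamma> ^ Suc D * real n powr \<theta>) \<longlonglongrightarrow> 0" by real_asymp
    have le: "\<forall>\<^sub>F n in sequentially. real (m n) * (real n * p n) ^ Suc D
        \<le> \<beta> * \<gamma> ^ Suc D * real n powr \<theta>"
      using eventually_gt_at_top[of 0]
    proof eventually_elim
      case (elim n)
      have "real n * p n = \<gamma> * (real n powr 1 * real n powr (-(1 + \<alpha>) / 2))"
        using elim by (simp add: p_def)
      also have "\<dots> = \<gamma> * real n powr ((1 - \<alpha>) / 2)"
        by (subst powr_add[symmetric]) (simp add: field_simps)
      finally have np: "real n * p n = \<gamma> * real n powr ((1 - \<alpha>) / 2)" .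
      have pow: "(real n powr ((1 - \<alpha>) / 2)) ^ Suc D = real n powr (real (Suc D) * ((1 - \<alpha>) / 2))"
        using elim by (subst powr_realpow[symmetric]) (simp_all only: powr_powr mult.commute, simp)
      have "real (m n) * (real n * p n) ^ Suc D \<le> \<beta> * real n powr \<alpha> * (real n * p n) ^ Suc D"
        using m_le assms by (intro mult_right_mono zero_le_power) (auto simp: np)
      also have "\<dots> = \<beta> * \<gamma> ^ Suc D * (real n powr \<alpha> * real n powr (real (Suc D) * ((1 - \<alpha>) / 2)))"
        by (simp only: np power_mult_distrib pow mult_ac)
      also have "\<dots> = \<beta> * \<gamma> ^ Suc D * real n powr \<theta>"
        by (simp only: powr_add[symmetric] \<theta>_def)
      finally show ?case .
    qed
    have "0 \<le> real (m n) * (real n * p n) ^ Suc D" for n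
      using assms by (simp add: p_def)
    then show ?thesis
      by (intro tendsto_sandwich[OF _ le tendsto_const[of 0] lim] always_eventually allI)
  qed
  have prob: "(\<lambda>n. measure_pmf.prob (rand_bip n (m n) (p n)) {B. \<not> good k n B}) \<longlonglongrightarrow> 0" for k
  proof (rule tendsto_sandwich[OF _ _ tendsto_const[of 0]])
    show "(\<lambda>n. real (m n) * (real n * p n) ^ Suc D + 1 / real n) \<longlonglongrightarrow> 0"
      using tendsto_add[OF large lim_1_over_n] by simp
    show "\<forall>\<^sub>F n in sequentially. measure_pmf.prob (rand_bip n (m n) (p n)) {B. \<not> good k n B}
        \<le> real (m n) * (real n * p n) ^ Suc D + 1 / real n"
      using p01 eventually_gt_at_top[of 0]
    proof eventually_elim
      case (elim n)
      have "{B. \<not> good k n B} = {B. \<exists>a<m n. D < card {u. u < n \<and> B (u, a)}} \<union>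
          {B. dense_trail_system n (m n) k (F k) B}"
        by (auto simp: good_def not_le)
      then have "measure_pmf.prob (rand_bip n (m n) (p n)) {B. \<not> good k n B} \<le>
          measure_pmf.prob (rand_bip n (m n) (p n)) {B. \<exists>a<m n. D < card {u. u < n \<and> B (u, a)}} +
          measure_pmf.prob (rand_bip n (m n) (p n)) {B. dense_trail_system n (m n) k (F k) B}"
        by (simp add: measure_Un_le)
      also have "\<dots> \<le> real (m n) * (real n * p n) ^ Suc D + 1 / real n"
        by (intro add_mono prob_large_attribute_le prob_dense_trail_system_le[OF _ _ c F] elim)
      finally show ?case .
    qed
  qed simp
  have tgrad: "tgrad {..<n} (rig_adj (m n) B) k \<le> real (f k)" if "good k n B" for k n B
    unfolding f_def using that by (intro tgrad_le) (simp_all add: good_def)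
  show "bounded_expansion G"
    unfolding bounded_expansion_def
  proof (intro exI[of _ "\<lambda>k. real (f k)"] allI)
    show "whp G (\<lambda>n adj. tgrad {..<n} adj k \<le> real (f k))" for k
      unfolding G using tgrad prob[of k] by (rule whp_RIG_I)
  qed
  \<comment> \<open>Depth 0 already controls the degeneracy, so one constant serves for all
    \<open>n\<close>.\<close>
  have deg: "real (degeneracy {..<n} (rig_adj (m n) B)) \<le> 2 * real (f 0)" if "n > 0" "good 0 n B" for n B
  proof -
    have "real (degeneracy {..<n} (rig_adj (m n) B)) \<le> 2 * tgrad {..<n} (rig_adj (m n) B) 0"
      using that(1) by (intro degeneracy_le_tgrad) (auto simp: rig_adj_def)
    with tgrad[OF that(2)] show ?thesis by linarith
  qed
  show "\<exists>C. whp G (\<lambda>n adj. real (degeneracy {..<n} adj) \<le> C)"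
    unfolding G using deg prob[of 0] by (intro exI[of _ "2 * real (f 0)"] whp_RIG_I)
qed

theorem mainTheorem1:
  fixes \<alpha> \<beta> \<gamma> :: real
  assumes "\<alpha> > 0" "\<beta> > 0" "\<gamma> > 0"
  defines "G \<equiv> (\<lambda>n::nat. RIG n (nat \<lfloor>\<beta> * real n powr \<alpha>\<rfloor>) (\<gamma> * real n powr (-(1 + \<alpha>) / 2)))"
  shows "(\<alpha> < 1 \<longrightarrow> somewhere_dense G \<and>
            (\<exists>c>0. whp G (\<lambda>n adj. real (degeneracy {..<n} adj) \<ge> c * \<gamma> * real n powr ((1 - \<alpha>) / 2))))
       \<and> (\<alpha> = 1 \<longrightarrow> somewhere_dense G \<and>
            (\<exists>c>0. whp G (\<lambda>n adj. real (degeneracy {..<n} adj) \<ge> c * ln (real n) / ln (ln (real n)))))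
       \<and> (\<alpha> > 1 \<longrightarrow> bounded_expansion G \<and>
            (\<exists>C. whp G (\<lambda>n adj. real (degeneracy {..<n} adj) \<le> C)))"
proof (intro conjI impI)
  assume "\<alpha> < 1"
  note dense = dense_regime[OF assms(1-3) this, folded G_def]
  from dense show "somewhere_dense G" by blast
  show "\<exists>c>0. whp G (\<lambda>n adj. real (degeneracy {..<n} adj) \<ge> c * \<gamma> * real n powr ((1 - \<alpha>) / 2))"
    using dense(2) by (intro exI[of _ "1 / 4"] conjI) auto
next
  assume \<alpha>: "\<alpha> = 1"
  \<comment> \<open>Substituting \<alpha> without simplification yields the expression
    \<open>1 + 1\<close> with which \<open>critical_regime\<close> is stated.\<close>
  have "G = (\<lambda>n. RIG n (nat \<lfloor>\<beta> * real n powr 1\<rfloor>) (\<gamma> * real n powr (-(1 + 1) / 2)))"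
    unfolding G_def \<alpha> ..
  note critical = critical_regime[OF assms(2,3), folded this]
  from critical show "somewhere_dense G" by blast
  show "\<exists>c>0. whp G (\<lambda>n adj. real (degeneracy {..<n} adj) \<ge> c * ln (real n) / ln (ln (real n)))"
    using critical(2) by (intro exI[of _ "1 / 4"] conjI) auto
next
  assume "\<alpha> > 1"
  note sparse = sparse_regime[OF assms(2,3) this, folded G_def]
  from sparse show "bounded_expansion G" "\<exists>C. whp G (\<lambda>n adj. real (degeneracy {..<n} adj) \<le> C)"
    by blast+
qed

end
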